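(* There is an algorithm that, given an instance $(\mathcal{U},\mathcal{S},\mathcal{X},P,K)$ of the \textsc{Maximum Price Coverage} problem, computes a set $C\subseteq\mathcal{S}$ with $|C|\le K$ of maximum price $pr(C)$ in time $2^{|\mathcal{U}|}(|\mathcal{U}|+|\mathcal{S}|)^{O(1)}$.
   Context: \textsc{Maximum Price Coverage} (MPC): the input consists of a finite set $\mathcal{U}=\{e_1,\ldots,e_\nu\}$ (the universe), a collection $\mathcal{S}=\{S_1,\ldots,S_\mu\}$ of subsets of $\mathcal{U}$, a partition $\mathcal{X}=\{X_1,\ldots,X_\ell\}$ of $\mathcal{S}$ (each $X_j$ is a set of members of $\mathcal{S}$), a price function $P:\mathcal{U}\cup\mathcal{X}\to\mathbb{N}$, and a positive integer $K$. For $C\subseteq\mathcal{S}$, its price is $pr(C)=\sum_{e\in\bigcup_{S_i\in C}S_i}P(e)+\sum_{X_j\in\mathcal{X}:\,X_j\cap C\neq\emptyset}P(X_j)$. The task is to find a set $C\subseteq\mathcal{S}$ with $|C|\le K$ that maximizes $pr(C)$. *)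

theory Defs
  imports Main "HOL-Library.Disjoint_Sets"
begin

section \<open>Maximum Price Coverage\<close>

text \<open>
  The price function has domain \<open>\<U> \<union> \<X>\<close>, a disjoint union: \<open>Inl e\<close> is an element of the universe
  and \<open>Inr Y\<close> is a class of the partition.
\<close>

type_synonym 'u prices = "'u + 'u set set \<Rightarrow> nat"

definition mpc_instance :: "'u set \<Rightarrow> 'u set set \<Rightarrow> 'u set set set \<Rightarrow> nat \<Rightarrow> bool" where
  "mpc_instance U S X K \<longleftrightarrow> finite U \<and> S \<subseteq> Pow U \<and> partition_on S X \<and> K > 0"

definition price :: "'u set set set \<Rightarrow> 'u prices \<Rightarrow> 'u set set \<Rightarrow> nat" where
  "price X P C = (\<Sum>e\<in>\<Union>C. P (Inl e)) + (\<Sum>Y\<in>{Y \<in> X. Y \<inter> C \<noteq> {}}. P (Inr Y))"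

definition mpc_solution ::
  "'u set set \<Rightarrow> 'u set set set \<Rightarrow> 'u prices \<Rightarrow> nat \<Rightarrow> 'u set set \<Rightarrow> bool" where
  "mpc_solution S X P K C \<longleftrightarrow>
     C \<subseteq> S \<and> card C \<le> K \<and> (\<forall>C'. C' \<subseteq> S \<and> card C' \<le> K \<longrightarrow> price X P C' \<le> price X P C)"


section \<open>Random access machines\<close>

text \<open>
  The machine model is the unit-cost RAM on natural numbers, in structured form: finitely many
  registers, a memory with indirect addressing, and as arithmetic only addition, truncated
  subtraction and comparison. There is deliberately no unit-cost multiplication, so that the length
  of a number grows by at most one bit per step and the unit-cost measure is a reasonable one.
  Every node of an expression and every executed command costs one unit, which is the number
  of instructions of a jump-based RAM up to a constant factor depending on the program only.
\<close>

datatype aexp =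
    Const nat
  | Reg nat
  | Load aexp
  | Add aexp aexp
  | Sub aexp aexp

datatype bexp =
    Less aexp aexp
  | Equal aexp aexp

datatype com =
    Skip
  | Assign nat aexp
  | Store aexp aexp
  | Seq com com
  | Cond bexp com com
  | While bexp com

type_synonym state = "(nat \<Rightarrow> nat) \<times> (nat \<Rightarrow> nat)"  \<comment> \<open>registers and memory\<close>

fun aval :: "aexp \<Rightarrow> state \<Rightarrow> nat" where
  "aval (Const n) s = n"
| "aval (Reg r) s = fst s r"
| "aval (Load a) s = snd s (aval a s)"
| "aval (Add a b) s = aval a s + aval b s"
| "aval (Sub a b) s = aval a s - aval b s"

fun bval :: "bexp \<Rightarrow> state \<Rightarrow> bool" where
  "bval (Less a b) s \<longleftrightarrow> aval a s < aval b s"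
| "bval (Equal a b) s \<longleftrightarrow> aval a s = aval b s"

fun acost :: "aexp \<Rightarrow> nat" where
  "acost (Const n) = 1"
| "acost (Reg r) = 1"
| "acost (Load a) = 1 + acost a"
| "acost (Add a b) = 1 + acost a + acost b"
| "acost (Sub a b) = 1 + acost a + acost b"

fun bcost :: "bexp \<Rightarrow> nat" where
  "bcost (Less a b) = 1 + acost a + acost b"
| "bcost (Equal a b) = 1 + acost a + acost b"

text \<open>\<open>exec c s t s'\<close>: started in state \<open>s\<close>, the program \<open>c\<close> halts after time \<open>t\<close> in state \<open>s'\<close>.\<close>

inductive exec :: "com \<Rightarrow> state \<Rightarrow> nat \<Rightarrow> state \<Rightarrow> bool" where
  Skip: "exec Skip s 1 s"
| Assign: "exec (Assign r a) s (1 + acost a) ((fst s)(r := aval a s), snd s)"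
| Store: "exec (Store a b) s (1 + acost a + acost b) (fst s, (snd s)(aval a s := aval b s))"
| Seq: "exec c1 s1 t1 s2 \<Longrightarrow> exec c2 s2 t2 s3 \<Longrightarrow> exec (Seq c1 c2) s1 (t1 + t2) s3"
| CondTrue: "bval b s \<Longrightarrow> exec c1 s t s' \<Longrightarrow> exec (Cond b c1 c2) s (1 + bcost b + t) s'"
| CondFalse: "\<not> bval b s \<Longrightarrow> exec c2 s t s' \<Longrightarrow> exec (Cond b c1 c2) s (1 + bcost b + t) s'"
| WhileFalse: "\<not> bval b s \<Longrightarrow> exec (While b c) s (1 + bcost b) s"
| WhileTrue: "bval b s1 \<Longrightarrow> exec c s1 t1 s2 \<Longrightarrow> exec (While b c) s2 t2 s3 \<Longrightarrow>
    exec (While b c) s1 (1 + bcost b + t1 + t2) s3"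

inductive_cases exec_SkipE: "exec Skip s t s'"
inductive_cases exec_AssignE: "exec (Assign r a) s t s'"
inductive_cases exec_StoreE: "exec (Store a b) s t s'"
inductive_cases exec_SeqE: "exec (Seq c1 c2) s t s'"
inductive_cases exec_CondE: "exec (Cond b c1 c2) s t s'"
inductive_cases exec_WhileE: "exec (While b c) s t s'"

lemma exec_deterministic:
  "exec c s t s' \<Longrightarrow> exec c s u s'' \<Longrightarrow> u = t \<and> s'' = s'"
proof (induction arbitrary: u s'' rule: exec.induct)
  case (Skip s)
  then show ?case by (auto elim: exec_SkipE)
next
  case (Assign r a s)
  then show ?case by (auto elim: exec_AssignE)
next
  case (Store a b s)
  then show ?case by (auto elim: exec_StoreE)
next
  case (Seq c1 s1 t1 s2 c2 t2 s3)
  from Seq.prems obtain v1 v2 r where v: "u = v1 + v2" "exec c1 s1 v1 r" "exec c2 r v2 s''"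
    by (rule exec_SeqE)
  from Seq.IH(1)[OF v(2)] Seq.IH(2) v show ?case by simp
next
  case (CondTrue b s c1 t s' c2)
  from CondTrue.prems CondTrue.hyps(1) obtain v where v: "u = 1 + bcost b + v" "exec c1 s v s''"
    by (elim exec_CondE) simp_all
  from CondTrue.IH[OF v(2)] v(1) show ?case by simp
next
  case (CondFalse b s c2 t s' c1)
  from CondFalse.prems CondFalse.hyps(1) obtain v where v: "u = 1 + bcost b + v" "exec c2 s v s''"
    by (elim exec_CondE) simp_all
  from CondFalse.IH[OF v(2)] v(1) show ?case by simp
next
  case (WhileFalse b s c)
  from WhileFalse.prems show ?case by (rule exec_WhileE) (use WhileFalse.hyps in simp_all)
next
  case (WhileTrue b s1 c t1 s2 t2 s3)
  from WhileTrue.prems obtain v1 v2 r where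
    v: "u = 1 + bcost b + v1 + v2" "exec c s1 v1 r" "exec (While b c) r v2 s''"
    by (rule exec_WhileE) (use WhileTrue.hyps(1) in simp_all)
  from WhileTrue.IH(1)[OF v(2)] WhileTrue.IH(2) v show ?case by simp
qed

definition initial_state :: "nat list \<Rightarrow> state" where
  "initial_state w = ((\<lambda>r. 0), (\<lambda>a. if a < length w then w ! a else 0))"


section \<open>Input and output of an algorithm for Maximum Price Coverage\<close>

definition enumerates :: "'a list \<Rightarrow> 'a set \<Rightarrow> bool" where
  "enumerates as A \<longleftrightarrow> distinct as \<and> set as = A"

text \<open>
  For enumerations \<open>us\<close>, \<open>ss\<close>, \<open>xs\<close> of \<open>\<U>\<close>, \<open>\<S>\<close>, \<open>\<X>\<close> the input consists of the four numbers
  \<open>|\<U>|\<close>, \<open>|\<S>|\<close>, \<open>|\<X>|\<close>, \<open>K\<close>, the prices of the elements and of the classes, the 0/1 incidence matrix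
  of sets (rows) and elements (columns), and the 0/1 incidence matrix of classes (rows) and
  sets (columns), each matrix row by row. A price occupies a single memory cell.
\<close>

definition mpc_encode ::
  "'u list \<Rightarrow> 'u set list \<Rightarrow> 'u set set list \<Rightarrow> 'u prices \<Rightarrow> nat \<Rightarrow> nat list" where
  "mpc_encode us ss xs P K =
     [length us, length ss, length xs, K]
     @ map (\<lambda>e. P (Inl e)) us
     @ map (\<lambda>Y. P (Inr Y)) xs
     @ concat (map (\<lambda>A. map (\<lambda>e. of_bool (e \<in> A)) us) ss)
     @ concat (map (\<lambda>Y. map (\<lambda>A. of_bool (A \<in> Y)) ss) xs)"

text \<open>The output is the characteristic vector of \<open>C\<close> in the first \<open>|\<S>|\<close> memory cells.\<close>

definition outputs :: "state \<Rightarrow> 'u set list \<Rightarrow> 'u set set \<Rightarrow> bool" where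
  "outputs s ss C \<longleftrightarrow> (\<forall>i < length ss. snd s i = of_bool (ss ! i \<in> C))"

text \<open>
  \<open>2 ^ |\<U>| * (|\<U>| + |\<S>|) ^ O(1)\<close> is read as \<open>c * 2 ^ |\<U>| * (|\<U>| + |\<S>|) ^ c\<close> for a constant \<open>c\<close>;
  the \<open>max 1\<close> is relevant only for the empty instance, whose literal bound would be zero.
\<close>

definition mpc_time_bound :: "nat \<Rightarrow> 'u set \<Rightarrow> 'u set set \<Rightarrow> nat" where
  "mpc_time_bound c U S = c * 2 ^ card U * (max 1 (card U + card S)) ^ c"

end

(*
Dynamic programming over the subsets Z of the universe. Let T(Z, k) be the largest price, with only
the elements of Z counted, of at most k of the sets treated so far. The sets are treated class by
class. A collection that contains the new set A of the class Y counts w(Z \<inter> A) for the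
elements of A, and its other sets count only on Z - A. So, with F the table T at the start of
the class Y,

  T'(Z, k + 1) = max {T(Z, k + 1), T(Z - A, k) + w(Z \<inter> A), F(Z - A, k) + w(Z \<inter> A) + P(Y)};

if no other set of Y is chosen, the third term gives the price of Y, and otherwise the second term
already contains it. All the sets Z - A and weights w(Z \<inter> A) come from tables that are
doubled once for every element, so no multiplication, division or bit operation is needed, and
each set costs 2^n times a polynomial.
*)
theory Submission
  imports Defs "HOL-Library.Nat_Bijection"
begin

section \<open>Weakest preconditions with running time\<close>

text \<open>Coverage is not additive, since sets overlap; fixing \<open>Z\<close> and passing to
  \<open>Z - A\<close> restores additivity, with a single predecessor for each choice, so a cell
  costs constant time. The price of a class is the other obstacle: whether \<open>Y\<close> is
  already paid for depends on the collection and not on its value. Instead of recording this, both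
  possibilities are compared. Neither overshoots: the second term may omit \<open>P(Y)\<close> but
  never charges it twice, and \<open>F\<close> knows only sets outside \<open>Y\<close>, so adding
  \<open>P(Y)\<close> is legitimate. Every term is thus at most the price of a real collection, and
  for the best one some term is exact. A fresh layer for every set keeps \<open>F\<close> intact
  during its class and lets zero memory serve as the base cases. As \<open>K\<close> may be
  arbitrarily large, it is capped at the number of sets, which keeps the number of rows
  polynomial.\<close>

definition wp :: "com \<Rightarrow> (nat \<Rightarrow> state \<Rightarrow> bool) \<Rightarrow> state \<Rightarrow> bool" where
  "wp c Q s \<longleftrightarrow> (\<exists>t s'. exec c s t s' \<and> Q t s')"

lemma wp_mono: "wp c Q s \<Longrightarrow> (\<And>t s'. Q t s' \<Longrightarrow> Q' t s') \<Longrightarrow> wp c Q' s"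
  unfolding wp_def by blast

lemma wpI: "exec c s t s' \<Longrightarrow> Q t s' \<Longrightarrow> wp c Q s"
  unfolding wp_def by blast

lemma wpE: "wp c Q s \<Longrightarrow> (\<And>t s'. exec c s t s' \<Longrightarrow> Q t s' \<Longrightarrow> R) \<Longrightarrow> R"
  unfolding wp_def by blast

text \<open>Determinism makes the run unique, so the existential can be evaluated at any known run;
  the rules for single commands become equivalences fit for simp.\<close>

lemma wp_det: "exec c s t s' \<Longrightarrow> wp c Q s \<longleftrightarrow> Q t s'"
  unfolding wp_def using exec_deterministic by blast

lemma wp_Skip [simp]: "wp Skip Q s \<longleftrightarrow> Q 1 s"
  by (rule wp_det[OF exec.Skip])

lemma wp_Assign [simp]:
  "wp (Assign r a) Q s \<longleftrightarrow> Q (1 + acost a) ((fst s)(r := aval a s), snd s)"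
  by (rule wp_det[OF exec.Assign])

lemma wp_Store [simp]:
  "wp (Store a b) Q s \<longleftrightarrow> Q (1 + acost a + acost b) (fst s, (snd s)(aval a s := aval b s))"
  by (rule wp_det[OF exec.Store])

lemma wp_Seq [simp]:
  "wp (Seq c1 c2) Q s \<longleftrightarrow> wp c1 (\<lambda>t1. wp c2 (\<lambda>t2. Q (t1 + t2))) s"
proof
  assume "wp (Seq c1 c2) Q s"
  then obtain t s' where "exec (Seq c1 c2) s t s'" "Q t s'" by (rule wpE)
  then show "wp c1 (\<lambda>t1. wp c2 (\<lambda>t2. Q (t1 + t2))) s"
    by (auto elim!: exec_SeqE intro!: wpI)
next
  assume "wp c1 (\<lambda>t1. wp c2 (\<lambda>t2. Q (t1 + t2))) s"
  then show "wp (Seq c1 c2) Q s"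
    by (elim wpE) (rule wpI[OF exec.Seq])
qed

lemma wp_Cond [simp]:
  "wp (Cond b c1 c2) Q s \<longleftrightarrow> wp (if bval b s then c1 else c2) (\<lambda>t. Q (1 + bcost b + t)) s"
proof
  assume "wp (Cond b c1 c2) Q s"
  then obtain t s' where "exec (Cond b c1 c2) s t s'" "Q t s'" by (rule wpE)
  then show "wp (if bval b s then c1 else c2) (\<lambda>t. Q (1 + bcost b + t)) s"
    by (auto elim!: exec_CondE intro: wpI)
next
  assume "wp (if bval b s then c1 else c2) (\<lambda>t. Q (1 + bcost b + t)) s"
  then show "wp (Cond b c1 c2) Q s"
    by (elim wpE) (auto split: if_splits intro: wpI[OF exec.CondTrue] wpI[OF exec.CondFalse])
qed

text \<open>The invariant is indexed by the number of finished rounds, so \<open>b - k\<close>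
  yields both termination and the time bound; the guard is evaluated once more often than the
  body.\<close>

lemma wp_While:
  assumes "\<And>k s. k < b \<Longrightarrow> I k s \<Longrightarrow> bval g s \<and> wp body (\<lambda>t s'. t \<le> B \<and> I (Suc k) s') s"
    and "\<And>s. I b s \<Longrightarrow> \<not> bval g s"
    and "k \<le> b" "I k s"
  shows "wp (While g body) (\<lambda>t s'. t \<le> (1 + bcost g) * Suc (b - k) + (b - k) * B \<and> I b s') s"
  using assms(3,4)
proof (induction "b - k" arbitrary: k s)
  case 0
  then have "k = b" by simp
  show ?case
    by (rule wpI[OF exec.WhileFalse]) (use assms(2) 0 \<open>k = b\<close> in simp_all)
next
  case (Suc d)
  then have k: "k < b" by simp
  from assms(1)[OF k Suc.prems(2)] obtain t s' where
    1: "bval g s" "exec body s t s'" "t \<le> B" "I (Suc k) s'" by (auto elim: wpE)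
  have "d = b - Suc k" "Suc k \<le> b" using Suc.hyps(2) k by simp_all
  from Suc.hyps(1)[OF this 1(4)] obtain t' s'' where
    2: "exec (While g body) s' t' s''" "t' \<le> (1 + bcost g) * Suc d + d * B" "I b s''"
    unfolding \<open>d = b - Suc k\<close>[symmetric] by (elim wpE) simp
  have "exec (While g body) s (1 + bcost g + t + t') s''"
    using exec.WhileTrue[OF 1(1,2) 2(1)] .
  moreover have "1 + bcost g + t + t' \<le> (1 + bcost g) * Suc (b - k) + (b - k) * B"
    unfolding Suc.hyps(2)[symmetric] using 1(3) 2(2) by (simp add: algebra_simps)
  ultimately show ?case using 2(3) by (intro wpI conjI)
qed

definition For :: "nat \<Rightarrow> nat \<Rightarrow> com \<Rightarrow> com" where
  "For i r body = Seq (Assign i (Const 0))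
     (While (Less (Reg i) (Reg r)) (Seq body (Assign i (Add (Reg i) (Const 1)))))"

text \<open>Besides its body a round pays 4 for the guard and 4 for the increment; the 6 is the
  initial assignment and the last test. \<open>I (Suc k)\<close> is asked of the state after the
  increment, which the body itself does not perform.\<close>

lemma wp_For:
  assumes init: "I 0 ((fst s)(i := 0), snd s)" "fst s r = b" "i \<noteq> r"
    and step: "\<And>k s. k < b \<Longrightarrow> I k s \<Longrightarrow> fst s i = k \<Longrightarrow> fst s r = b \<Longrightarrow>
      wp body (\<lambda>t s'. t \<le> B \<and> fst s' i = k \<and> fst s' r = b \<and> I (Suc k) ((fst s')(i := Suc k), snd s')) s"
    and T: "6 + b * (B + 8) \<le> T"
    and post: "\<And>t s'. t \<le> T \<Longrightarrow> I b s' \<Longrightarrow> fst s' i = b \<Longrightarrow> fst s' r = b \<Longrightarrow> Q t s'"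
  shows "wp (For i r body) Q s"
proof -
  define J where "J k s \<longleftrightarrow> I k s \<and> fst s i = k \<and> fst s r = b" for k s
  let ?s = "((fst s)(i := 0), snd s)"
  have J0: "J 0 ?s" using init by (simp add: J_def)
  have st: "bval (Less (Reg i) (Reg r)) s \<and>
      wp (Seq body (Assign i (Add (Reg i) (Const 1)))) (\<lambda>t s'. t \<le> B + 4 \<and> J (Suc k) s') s"
    if "k < b" "J k s" for k s
    using that step[of k s] init(3) by (auto simp: J_def elim!: wp_mono)
  have "wp (While (Less (Reg i) (Reg r)) (Seq body (Assign i (Add (Reg i) (Const 1)))))
      (\<lambda>t s'. t \<le> (1 + bcost (Less (Reg i) (Reg r))) * Suc (b - 0) + (b - 0) * (B + 4) \<and> J b s') ?s"
    by (rule wp_While[OF st _ _ J0]) (auto simp: J_def)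
  then show ?thesis unfolding For_def using T
    by (auto simp: J_def algebra_simps elim!: wp_mono intro!: post)
qed

section \<open>Finite sets of numbers as binary numbers\<close>

lemma set_encode_lessThan: "set_encode {..<n} = 2 ^ n - 1"
  using mask_eq_sum_exp_nat[of n] by (simp add: set_encode_def lessThan_def)

lemma set_decode_subset:
  assumes "z < 2 ^ n" shows "set_decode z \<subseteq> {..<n}"
proof
  fix x assume "x \<in> set_decode z"
  then have "z div 2 ^ x \<noteq> 0" by (auto simp: set_decode_def intro: ccontr)
  then have "2 ^ x \<le> z" by (simp add: div_eq_0_iff)
  then have "(2::nat) ^ x < 2 ^ n" using assms by (rule le_less_trans)
  then show "x \<in> {..<n}" by simp
qed

lemma set_encode_less:
  assumes "C \<subseteq> {..<n}" shows "set_encode C < 2 ^ n"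
proof -
  have "set_encode C \<le> set_encode {..<n}"
    using assms unfolding set_encode_def by (intro sum_mono2) auto
  moreover have "(0::nat) < 2 ^ n" by simp
  ultimately show ?thesis unfolding set_encode_lessThan by linarith
qed

text \<open>The numbers from \<open>2 ^ e\<close> to below \<open>2 ^ Suc e\<close> are the sets
  with largest element \<open>e\<close>, so a table over the subsets of \<open>{..<e}\<close> is
  extended by \<open>e\<close> by appending a modified copy of itself.\<close>

lemma set_decode_add_power:
  assumes "z < 2 ^ e" shows "set_decode (z + 2 ^ e) = insert e (set_decode z)" "e \<notin> set_decode z"
proof -
  show *: "e \<notin> set_decode z" using set_decode_subset[OF assms] by auto
  show "set_decode (z + 2 ^ e) = insert e (set_decode z)"
    using set_decode_plus_power_2[OF *] by (simp add: add.commute)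
qed

lemma set_decode_power_minus_1: "set_decode (2 ^ n - 1) = {..<n}"
  using set_encode_inverse[OF finite_lessThan, of n] by (simp only: set_encode_lessThan)

section \<open>The recursion for optimal collections\<close>

locale indexed_mpc =
  fixes n m l K :: nat and pe pc :: "nat \<Rightarrow> nat" and A :: "nat \<Rightarrow> nat set" and cl :: "nat \<Rightarrow> nat"
  assumes cl_less: "i < m \<Longrightarrow> cl i < l"
begin

text \<open>
  Sets and classes are indices: \<open>A i\<close> is the \<open>i\<close>-th set and \<open>cl i\<close> the class containing it. The price is
  restricted to the elements of \<open>Z\<close>.
\<close>

definition val :: "nat set \<Rightarrow> nat set \<Rightarrow> nat" where
  "val Z C = sum pe (Z \<inter> \<Union>(A ` C)) + sum pc (cl ` C)"

lemma val_empty [simp]: "val Z {} = 0"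
  by (simp add: val_def)

lemma val_insert:
  assumes "finite Z" "finite C"
  shows "val Z (insert i C) =
    sum pe (Z \<inter> A i) + val (Z - A i) C + (if cl i \<in> cl ` C then 0 else pc (cl i))"
proof -
  have "Z \<inter> \<Union>(A ` insert i C) = (Z \<inter> A i) \<union> ((Z - A i) \<inter> \<Union>(A ` C))" by auto
  also have "sum pe \<dots> = sum pe (Z \<inter> A i) + sum pe ((Z - A i) \<inter> \<Union>(A ` C))"
    using assms by (intro sum.union_disjoint) auto
  finally show ?thesis using assms by (simp add: val_def insert_absorb)
qed

text \<open>Only \<open>v \<le> val Z C\<close> is asked, because the transition that omits the
  class price may understate the price of its witness. The upper bound in \<open>optimal\<close>
  forces equality.\<close>

definition candidate :: "nat set \<Rightarrow> nat \<Rightarrow> nat set \<Rightarrow> nat \<Rightarrow> nat \<Rightarrow> bool" where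
  "candidate I k Z v x \<longleftrightarrow> (\<exists>C. C \<subseteq> I \<and> card C \<le> k \<and> x = set_encode C \<and> v \<le> val Z C)"

definition optimal :: "nat set \<Rightarrow> nat \<Rightarrow> nat set \<Rightarrow> nat \<Rightarrow> nat \<Rightarrow> bool" where
  "optimal I k Z v x \<longleftrightarrow> candidate I k Z v x \<and> (\<forall>C. C \<subseteq> I \<and> card C \<le> k \<longrightarrow> val Z C \<le> v)"

lemma optimal_0:
  assumes "finite I" shows "optimal I 0 Z 0 0"
proof -
  have "val Z C \<le> 0" if "C \<subseteq> I" "card C \<le> 0" for C
  proof -
    \<comment> \<open>Finiteness matters: an infinite \<open>C\<close> would also have cardinality
      0.\<close>
    have "C = {}" using that finite_subset[OF _ assms] by simp
    then show ?thesis by simp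
  qed
  moreover have "candidate I 0 Z 0 0"
    unfolding candidate_def by (rule exI[of _ "{}"]) simp
  ultimately show ?thesis by (simp add: optimal_def)
qed

lemma optimal_empty: "optimal {} k Z 0 0"
  unfolding optimal_def candidate_def by auto

text \<open>Serves both transitions: \<open>J = I\<close> with \<open>b = 0\<close>, and
  \<open>J\<close> outside the class of \<open>i\<close> with \<open>b = pc (cl i)\<close>. The
  condition on \<open>b\<close> passes from \<open>J\<close> to its subset \<open>C\<close>, since a
  class missed by \<open>J\<close> is missed by \<open>C\<close>.\<close>

lemma candidate_insert:
  assumes "candidate J k (Z - A i) v x" "finite Z" "finite I" "J \<subseteq> I" "i \<notin> I"
    and "b \<le> (if cl i \<in> cl ` J then 0 else pc (cl i))"
  shows "candidate (insert i I) (Suc k) Z (v + sum pe (Z \<inter> A i) + b) (x + 2 ^ i)"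
proof -
  obtain C where C: "C \<subseteq> J" "card C \<le> k" "x = set_encode C" "v \<le> val (Z - A i) C"
    using assms(1) by (auto simp: candidate_def)
  have f: "finite C" using finite_subset[OF C(1)] finite_subset[OF assms(4,3)] .
  have i: "i \<notin> C" using C(1) assms(4,5) by blast
  have "b \<le> (if cl i \<in> cl ` C then 0 else pc (cl i))"
    using assms(6) C(1) by (auto split: if_splits)
  then have "v + sum pe (Z \<inter> A i) + b \<le> val Z (insert i C)"
    using C(4) by (simp add: val_insert[OF assms(2) f])
  moreover have "insert i C \<subseteq> insert i I" using C(1) assms(4) by blast
  moreover have "card (insert i C) \<le> Suc k" using C(2) f i by simp
  moreover have "x + 2 ^ i = set_encode (insert i C)" using C(3) f i by simp
  ultimately show ?thesis unfolding candidate_def by blast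
qed

lemma candidate_mono: "candidate I k Z v x \<Longrightarrow> I \<subseteq> I' \<Longrightarrow> candidate I' k Z v x"
  unfolding candidate_def by blast

text \<open>
  \<open>I\<close> are the sets treated before \<open>i\<close>, and \<open>J\<close> those outside the class of \<open>i\<close>. A collection that
  contains \<open>i\<close> earns the price of the class together with \<open>i\<close> only if its rest lies in \<open>J\<close>.
\<close>

lemma optimal_insert:
  assumes G: "optimal I (Suc k) Z v0 x0" "optimal I k (Z - A i) v1 x1"
    and F: "optimal J k (Z - A i) v2 x2"
    and fin: "finite Z" "finite I" and I: "i \<notin> I" "J = {i' \<in> I. cl i' \<noteq> cl i}"
    and w: "w = sum pe (Z \<inter> A i)"
    and 1: "(v3, x3) = (if v0 < v1 + w then (v1 + w, x1 + 2 ^ i) else (v0, x0))"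
    and 2: "(v4, x4) = (if v3 < v2 + w + pc (cl i) then (v2 + w + pc (cl i), x2 + 2 ^ i) else (v3, x3))"
  shows "optimal (insert i I) (Suc k) Z v4 x4"
proof -
  have "candidate (insert i I) (Suc k) Z v0 x0"
    using G(1) by (auto simp: optimal_def intro: candidate_mono)
  moreover have "candidate (insert i I) (Suc k) Z (v1 + w) (x1 + 2 ^ i)"
    using candidate_insert[of I k Z i v1 x1 I 0] G(2) fin I(1) w by (simp add: optimal_def)
  moreover have "candidate (insert i I) (Suc k) Z (v2 + w + pc (cl i)) (x2 + 2 ^ i)"
    unfolding w by (rule candidate_insert[of J]) (use F fin I in \<open>auto simp: optimal_def\<close>)
  ultimately have c: "candidate (insert i I) (Suc k) Z v4 x4"
    using 1 2 by (auto split: if_splits)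
  have v4: "v0 \<le> v4" "v1 + w \<le> v4" "v2 + w + pc (cl i) \<le> v4"
    using 1 2 by (auto split: if_splits)
  have "val Z C \<le> v4" if C: "C \<subseteq> insert i I" "card C \<le> Suc k" for C
  proof (cases "i \<in> C")
    case False
    then have "val Z C \<le> v0" using C G(1) by (auto simp: optimal_def)
    then show ?thesis using v4 by simp
  next
    case True
    define D where "D = C - {i}"
    have CD: "C = insert i D" and iD: "i \<notin> D" and D: "D \<subseteq> I"
      using True C by (auto simp: D_def)
    have fD: "finite D" using D fin(2) by (rule finite_subset)
    have cD: "card D \<le> k" using C(2) fD iD by (simp add: CD)
    show ?thesis
    proof (cases "cl i \<in> cl ` D")
      case True
      have "val (Z - A i) D \<le> v1" using G(2) D cD by (auto simp: optimal_def)
      then show ?thesis using True v4 w by (simp add: CD val_insert[OF fin(1) fD])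
    next
      case False
      then have "D \<subseteq> J" using D unfolding I(2) image_iff by fastforce
      then have "val (Z - A i) D \<le> v2" using F cD by (auto simp: optimal_def)
      then show ?thesis using False v4 w by (simp add: CD val_insert[OF fin(1) fD])
    qed
  qed
  with c show ?thesis by (simp add: optimal_def)
qed

end

section \<open>One step of the dynamic program\<close>

abbreviation (input) plus_aexp (infixl "\<oplus>" 65) where "a \<oplus> b \<equiv> Add a b"
abbreviation (input) minus_aexp (infixl "\<ominus>" 65) where "a \<ominus> b \<equiv> Sub a b"
abbreviation (input) seq_com (infixr ";;" 60) where "c ;; d \<equiv> Seq c d"
abbreviation (input) assign_com (infix "::=" 61) where "r ::= a \<equiv> Assign r a"
abbreviation (input) reg_n :: nat where "reg_n \<equiv> 0"
abbreviation (input) reg_m :: nat where "reg_m \<equiv> 1"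
abbreviation (input) reg_l :: nat where "reg_l \<equiv> 2"
abbreviation (input) reg_K :: nat where "reg_K \<equiv> 3"
abbreviation (input) reg_sets :: nat where "reg_sets \<equiv> 4"
abbreviation (input) reg_classes :: nat where "reg_classes \<equiv> 5"
abbreviation (input) reg_free :: nat where "reg_free \<equiv> 6"
abbreviation (input) reg_N :: nat where "reg_N \<equiv> 7"
abbreviation (input) reg_H :: nat where "reg_H \<equiv> 8"
abbreviation (input) reg_top :: nat where "reg_top \<equiv> 9"
abbreviation (input) reg_i :: nat where "reg_i \<equiv> 10"
abbreviation (input) reg_j :: nat where "reg_j \<equiv> 11"
abbreviation (input) reg_e :: nat where "reg_e \<equiv> 12"
abbreviation (input) reg_z :: nat where "reg_z \<equiv> 13"
abbreviation (input) reg_p :: nat where "reg_p \<equiv> 14"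
abbreviation (input) reg_k :: nat where "reg_k \<equiv> 15"
abbreviation (input) reg_G :: nat where "reg_G \<equiv> 16"
abbreviation (input) reg_F :: nat where "reg_F \<equiv> 17"
abbreviation (input) reg_Q :: nat where "reg_Q \<equiv> 18"
abbreviation (input) reg_cell :: nat where "reg_cell \<equiv> 19"
abbreviation (input) reg_row :: nat where "reg_row \<equiv> 20"
abbreviation (input) reg_pow :: nat where "reg_pow \<equiv> 21"
abbreviation (input) reg_cp :: nat where "reg_cp \<equiv> 22"
abbreviation (input) reg_x :: nat where "reg_x \<equiv> 23"
abbreviation (input) reg_y :: nat where "reg_y \<equiv> 24"
abbreviation (input) reg_v :: nat where "reg_v \<equiv> 25"
abbreviation (input) reg_w :: nat where "reg_w \<equiv> 26"
abbreviation (input) reg_u :: nat where "reg_u \<equiv> 27"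
abbreviation (input) reg_o :: nat where "reg_o \<equiv> 28"
abbreviation (input) reg_d :: nat where "reg_d \<equiv> 29"

text \<open>
  A subset of the universe is represented by the number \<open>z < N = 2 ^ n\<close> with its binary
  digits, a collection likewise by its mask. Above the input there are two tables of length \<open>N\<close>,
  holding \<open>Z - A i\<close> and the weight of \<open>Z \<inter> A i\<close> for the current set \<open>i\<close>, and then one layer of
  length \<open>2 * H\<close> for every set treated so far: \<open>H = (K + 1) * N\<close> values, the one for \<open>k\<close> and \<open>z\<close>
  in cell \<open>k * N + z\<close>, followed by as many masks. The layers at \<open>reg_G\<close>, \<open>reg_F\<close>, \<open>reg_Q\<close> are the
  latest one, the one at the start of the current class, and the one being written; its row \<open>k = 0\<close>
  is correct without being written, since fresh memory is zero.
\<close>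

definition double_tables :: com where
  "double_tables = For reg_z reg_p
    (Store (Reg reg_free \<oplus> Reg reg_z \<oplus> Reg reg_p) (Load (Reg reg_free \<oplus> Reg reg_z) \<oplus> Reg reg_x) ;;
     Store (Reg reg_free \<oplus> Reg reg_N \<oplus> Reg reg_z \<oplus> Reg reg_p)
       (Load (Reg reg_free \<oplus> Reg reg_N \<oplus> Reg reg_z) \<oplus> Reg reg_y))"

definition add_element :: com where
  "add_element =
     reg_x ::= Reg reg_p ;;
     reg_y ::= Const 0 ;;
     Cond (Equal (Load (Reg reg_row \<oplus> Reg reg_e)) (Const 1))
       (reg_x ::= Const 0 ;; reg_y ::= Load (Const 4 \<oplus> Reg reg_e)) Skip ;;
     double_tables ;;
     reg_p ::= Reg reg_p \<oplus> Reg reg_p"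

definition make_tables :: com where
  "make_tables =
     Store (Reg reg_free) (Const 0) ;;
     Store (Reg reg_free \<oplus> Reg reg_N) (Const 0) ;;
     reg_p ::= Const 1 ;;
     For reg_e reg_n add_element"

text \<open>With \<open>reg_o\<close> at \<open>k * N\<close>, the index \<open>reg_x\<close> reads
  row \<open>k\<close> at \<open>Z - A i\<close>, and \<open>reg_y\<close> belongs to row
  \<open>k + 1\<close> at \<open>Z\<close>. The registers \<open>reg_v\<close> and
  \<open>reg_w\<close> carry the best value so far and its mask.\<close>

definition update_cell :: com where
  "update_cell =
     reg_x ::= Reg reg_o \<oplus> Load (Reg reg_free \<oplus> Reg reg_z) ;;
     reg_d ::= Load (Reg reg_free \<oplus> Reg reg_N \<oplus> Reg reg_z) ;;
     reg_y ::= Reg reg_o \<oplus> Reg reg_N \<oplus> Reg reg_z ;;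
     reg_v ::= Load (Reg reg_G \<oplus> Reg reg_y) ;;
     reg_w ::= Load (Reg reg_G \<oplus> Reg reg_H \<oplus> Reg reg_y) ;;
     reg_u ::= Load (Reg reg_G \<oplus> Reg reg_x) \<oplus> Reg reg_d ;;
     Cond (Less (Reg reg_v) (Reg reg_u))
       (reg_v ::= Reg reg_u ;;
        reg_w ::= Load (Reg reg_G \<oplus> Reg reg_H \<oplus> Reg reg_x) \<oplus> Reg reg_pow) Skip ;;
     reg_u ::= Load (Reg reg_F \<oplus> Reg reg_x) \<oplus> Reg reg_d \<oplus> Reg reg_cp ;;
     Cond (Less (Reg reg_v) (Reg reg_u))
       (reg_v ::= Reg reg_u ;;
        reg_w ::= Load (Reg reg_F \<oplus> Reg reg_H \<oplus> Reg reg_x) \<oplus> Reg reg_pow) Skip ;;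
     Store (Reg reg_Q \<oplus> Reg reg_y) (Reg reg_v) ;;
     Store (Reg reg_Q \<oplus> Reg reg_H \<oplus> Reg reg_y) (Reg reg_w)"

definition make_layer :: com where
  "make_layer =
     reg_o ::= Const 0 ;;
     For reg_k reg_K
      (For reg_z reg_N update_cell ;;
       reg_o ::= Reg reg_o \<oplus> Reg reg_N)"

lemma row_index_less: "i < a \<Longrightarrow> j < b \<Longrightarrow> i * b + j < a * (b::nat)"
proof -
  assume "i < a" "j < b"
  then have "i * b + j < Suc i * b" by simp
  also have "\<dots> \<le> a * b" using \<open>i < a\<close> by (intro mult_right_mono) auto
  finally show ?thesis .
qed

section \<open>Memory layout and the tables for the current set\<close>

context indexed_mpc
begin

abbreviation N :: nat where "N \<equiv> 2 ^ n"

definition H :: nat where "H = K * N + N"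

definition free :: nat where "free = 4 + n + l + m * n + l * m"

text \<open>The four header cells are left out: their contents move to registers, and the stored
  bound may exceed the capped \<open>K\<close>.\<close>

definition is_input :: "(nat \<Rightarrow> nat) \<Rightarrow> bool" where
  "is_input f \<longleftrightarrow>
     (\<forall>e<n. f (4 + e) = pe e) \<and> (\<forall>j<l. f (4 + n + j) = pc j) \<and>
     (\<forall>i<m. \<forall>e<n. f (4 + n + l + i * n + e) = of_bool (e \<in> A i)) \<and>
     (\<forall>j<l. \<forall>i<m. f (4 + n + l + m * n + j * m + i) = of_bool (cl i = j))"

definition static :: "state \<Rightarrow> bool" where
  "static s \<longleftrightarrow> fst s reg_n = n \<and> fst s reg_m = m \<and> fst s reg_l = l \<and> fst s reg_K = K \<and>
     fst s reg_sets = 4 + n + l \<and> fst s reg_classes = 4 + n + l + m * n \<and>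
     fst s reg_free = free \<and> fst s reg_N = N \<and> fst s reg_H = H \<and> fst s reg_top = 2 ^ m \<and>
     is_input (snd s)"

lemma is_input_cong:
  assumes "is_input f" "\<And>a. a < free \<Longrightarrow> g a = f a" shows "is_input g"
proof -
  have "4 + n + l + i * n + e < free" if "i < m" "e < n" for i e
    using row_index_less[OF that] by (simp add: free_def)
  moreover have "4 + n + l + m * n + j * m + i < free" if "j < l" "i < m" for i j
    using row_index_less[OF that] by (simp add: free_def)
  moreover have "4 + e < free" if "e < n" for e using that by (simp add: free_def)
  moreover have "4 + n + j < free" if "j < l" for j using that by (simp add: free_def)
  ultimately show ?thesis using assms unfolding is_input_def by simp
qed

text \<open>Between set-up and output, no register below 10 and no cell below \<open>free\<close> is
  written, so this one rule preserves \<open>static\<close> throughout.\<close>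

lemma static_cong:
  assumes "static s" "\<And>x. x < 10 \<Longrightarrow> fst s' x = fst s x" "\<And>a. a < free \<Longrightarrow> snd s' a = snd s a"
  shows "static s'"
  using assms(1,2) is_input_cong[OF _ assms(3)] by (simp add: static_def)

definition table :: "(nat \<Rightarrow> nat) \<Rightarrow> nat \<Rightarrow> nat \<Rightarrow> bool" where
  "table f i z \<longleftrightarrow> f (free + z) = set_encode (set_decode z - A i) \<and>
     f (free + N + z) = sum pe (set_decode z \<inter> A i)"

text \<open>The element \<open>e\<close> joins exactly one of \<open>Z - A i\<close> and
  \<open>Z \<inter> A i\<close>, independently of \<open>Z\<close>, so one pair of increments serves
  a whole doubling pass.\<close>

lemma table_add_power:
  assumes "table f i z" "z < 2 ^ e"
    and "f' (free + (z + 2 ^ e)) = f (free + z) + (if e \<in> A i then 0 else 2 ^ e)"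
    and "f' (free + N + (z + 2 ^ e)) = f (free + N + z) + (if e \<in> A i then pe e else 0)"
  shows "table f' i (z + 2 ^ e)"
proof -
  note d = set_decode_add_power[OF assms(2)]
  have "set_decode (z + 2 ^ e) - A i = (if e \<in> A i then set_decode z - A i else insert e (set_decode z - A i))"
    "set_decode (z + 2 ^ e) \<inter> A i = (if e \<in> A i then insert e (set_decode z \<inter> A i) else set_decode z \<inter> A i)"
    unfolding d(1) by auto
  then show ?thesis using assms d(2) by (simp add: table_def)
qed

lemma double_tables:
  assumes r: "fst s reg_free = free" "fst s reg_N = N" "fst s reg_p = 2 ^ e" "e < n"
    and x: "fst s reg_x = (if e \<in> A i then 0 else 2 ^ e)"
    and y: "fst s reg_y = (if e \<in> A i then pe e else 0)"
    and t: "\<forall>z<2 ^ e. table (snd s) i z"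
  shows "wp double_tables (\<lambda>t s'. t \<le> N * 50 \<and>
     (\<forall>x. x \<noteq> reg_z \<longrightarrow> fst s' x = fst s x) \<and>
     (\<forall>a. a < free \<or> free + N + N \<le> a \<longrightarrow> snd s' a = snd s a) \<and>
     (\<forall>z<2 ^ Suc e. table (snd s') i z)) s"
proof -
  \<comment> \<open>The doubled length still fits into \<open>N\<close>, so the copies of the first
    table do not run into the second.\<close>
  have p: "2 * 2 ^ e \<le> N" "1 \<le> (2::nat) ^ e"
    using power_increasing[of "Suc e" n "2::nat"] \<open>e < n\<close> by simp_all
  have T: "6 + 2 ^ e * (30 + 8) \<le> N * 50" proof -
    have "6 + a * 38 \<le> b * 50" if "2 * a \<le> b" "1 \<le> a" for a b :: nat
      using that by linarith
    from this[OF p] show ?thesis by simp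
  qed
  let ?I = "\<lambda>k s'. (\<forall>x. x \<noteq> reg_z \<longrightarrow> fst s' x = fst s x) \<and>
     (\<forall>a. a < free \<or> free + N + N \<le> a \<longrightarrow> snd s' a = snd s a) \<and>
     (\<forall>z<2 ^ e + k. table (snd s') i z)"
  show ?thesis unfolding double_tables_def
  proof (rule wp_For[where I = ?I and b = "2 ^ e" and B = 30])
    fix k s' assume k: "k < 2 ^ e" and I: "?I k s'" and z: "fst s' reg_z = k"
    have *: "snd s' (free + k) + fst s reg_x = snd s' (free + k) + (if e \<in> A i then 0 else 2 ^ e)"
      "snd s' (free + N + k) + fst s reg_y = snd s' (free + N + k) + (if e \<in> A i then pe e else 0)"
      using x y by simp_all
    let ?f = "(snd s')(free + k + 2 ^ e := snd s' (free + k) + fst s reg_x,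
       free + N + k + 2 ^ e := snd s' (free + N + k) + fst s reg_y)"
    have "table ?f i (k + 2 ^ e)"
      by (rule table_add_power[of "snd s'"]) (use I k p x y in \<open>auto simp: algebra_simps\<close>)
    moreover have "table ?f i z" if "z < 2 ^ e + k" for z
      using I that k p by (auto simp: table_def)
    ultimately have "\<forall>z<Suc (2 ^ e + k). table ?f i z"
      by (auto simp: less_Suc_eq add.commute)
    then show "wp (Store (Reg reg_free \<oplus> Reg reg_z \<oplus> Reg reg_p) (Load (Reg reg_free \<oplus> Reg reg_z) \<oplus> Reg reg_x) ;;
     Store (Reg reg_free \<oplus> Reg reg_N \<oplus> Reg reg_z \<oplus> Reg reg_p)
       (Load (Reg reg_free \<oplus> Reg reg_N \<oplus> Reg reg_z) \<oplus> Reg reg_y))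
      (\<lambda>t s'. t \<le> 30 \<and> fst s' reg_z = k \<and> fst s' reg_p = 2 ^ e \<and>
         ?I (Suc k) ((fst s')(reg_z := Suc k), snd s')) s'"
      using I z r k p by simp
  qed (use assms T in auto)
qed


lemma make_tables:
  assumes s: "static s" and i: "i < m" and row: "fst s reg_row = 4 + n + l + i * n"
  shows "wp make_tables (\<lambda>t s'. t \<le> (n + 1) * (N * 150) \<and>
     (\<forall>x. x \<notin> {reg_e, reg_z, reg_p, reg_x, reg_y} \<longrightarrow> fst s' x = fst s x) \<and>
     (\<forall>a. a < free \<or> free + N + N \<le> a \<longrightarrow> snd s' a = snd s a) \<and>
     (\<forall>z<N. table (snd s') i z)) s"
proof -
  let ?I = "\<lambda>e s'. fst s' reg_p = 2 ^ e \<and>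
     (\<forall>x. x \<notin> {reg_e, reg_z, reg_p, reg_x, reg_y} \<longrightarrow> fst s' x = fst s x) \<and>
     (\<forall>a. a < free \<or> free + N + N \<le> a \<longrightarrow> snd s' a = snd s a) \<and>
     (\<forall>z<2 ^ e. table (snd s') i z)"
  have N: "1 \<le> N" by simp
  have inc: "snd s (4 + n + l + i * n + e) = of_bool (e \<in> A i)" "snd s (4 + e) = pe e" if "e < n" for e
    using s i that by (auto simp: static_def is_input_def)
  have free: "4 + n + l + i * n + e < free" if "e < n" for e
    using row_index_less[OF i that] by (simp add: free_def)
  \<comment> \<open>Each pass is charged for the full length \<open>N\<close>, although the lengths
    \<open>2 ^ e\<close> sum to less than \<open>N\<close>; the extra factor \<open>n\<close> is
    affordable.\<close>
  have T: "6 + n * (N * 50 + 40 + 8) + 20 \<le> (n + 1) * (N * 150)"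
    using mult_le_mono2[OF N, of n] N unfolding distrib_left distrib_right by linarith
  define s0 where "s0 = ((fst s)(reg_p := 1), (snd s)(free := 0, free + N := 0))"
  have loop: "wp (For reg_e reg_n add_element) (\<lambda>t s'. t \<le> 6 + n * (N * 50 + 40 + 8) \<and> ?I n s') s0"
  proof (rule wp_For[where I = ?I and b = n and B = "N * 50 + 40"])
    fix e s' assume e: "e < n" and I: "?I e s'" and es: "fst s' reg_e = e" and ns: "fst s' reg_n = n"
    have cell: "snd s' (4 + n + l + i * n + e) = of_bool (e \<in> A i)" "snd s' (4 + e) = pe e"
      using I inc[OF e] free[OF e] by (simp_all add: free_def)
    have R: "fst s' reg_row = 4 + n + l + i * n" "fst s' reg_free = free" "fst s' reg_N = N"
      using I row s by (simp_all add: static_def)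
    define s1 where "s1 = ((fst s')(reg_x := (if e \<in> A i then 0 else 2 ^ e),
       reg_y := (if e \<in> A i then pe e else 0)), snd s')"
    have d: "wp double_tables (\<lambda>t s'. t \<le> N * 50 \<and>
     (\<forall>x. x \<noteq> reg_z \<longrightarrow> fst s' x = fst s1 x) \<and>
     (\<forall>a. a < free \<or> free + N + N \<le> a \<longrightarrow> snd s' a = snd s1 a) \<and>
     (\<forall>z<2 ^ Suc e. table (snd s') i z)) s1"
      by (rule double_tables) (use I R e in \<open>simp_all add: s1_def\<close>)
    \<comment> \<open>The slack of 35 pays for the commands around the doubling pass; later bounds
      of the form \<open>t + 10\<close> or \<open>t + 20\<close> do the same for their
      surroundings.\<close>
    have d': "wp double_tables (\<lambda>t s'. t + 35 \<le> N * 50 + 40 \<and> fst s' reg_e = e \<and> fst s' reg_n = n \<and>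
         ?I (Suc e) ((fst s')(reg_p := fst s' reg_p + fst s' reg_p, reg_e := Suc e), snd s')) s1"
      by (rule wp_mono[OF d]) (use I es ns in \<open>auto simp: s1_def\<close>)
    show "wp add_element
       (\<lambda>t s'. t \<le> N * 50 + 40 \<and> fst s' reg_e = e \<and> fst s' reg_n = n \<and>
         ?I (Suc e) ((fst s')(reg_e := Suc e), snd s')) s'"
    proof (cases "e \<in> A i")
      case True
      have s1: "s1 = ((fst s')(reg_x := 0, reg_y := pe e), snd s')"
        using True by (simp add: s1_def)
      show ?thesis unfolding add_element_def using True I es R cell d'[unfolded s1]
        by (auto simp: fun_upd_twist fun_upd_upd elim!: wp_mono)
    next
      case False
      have s1: "s1 = ((fst s')(reg_x := 2 ^ e, reg_y := 0), snd s')"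
        using False by (simp add: s1_def)
      show ?thesis unfolding add_element_def using False I es R cell d'[unfolded s1]
        by (auto simp: fun_upd_twist fun_upd_upd elim!: wp_mono)
    qed
  qed (use s N in \<open>auto simp: s0_def static_def table_def\<close>)
  have "wp (For reg_e reg_n add_element) (\<lambda>t s'. t + 20 \<le> (n + 1) * (N * 150) \<and> ?I n s') s0"
    by (rule wp_mono[OF loop]) (use T in auto)
  then show ?thesis unfolding make_tables_def
    using s unfolding s0_def
    by (auto simp: static_def elim!: wp_mono)
qed

section \<open>Layers of optimal values and masks\<close>

definition layer :: "(nat \<Rightarrow> nat) \<Rightarrow> nat \<Rightarrow> nat set \<Rightarrow> nat \<Rightarrow> bool" where
  "layer f G I y \<longleftrightarrow> optimal I (y div N) (set_decode (y mod N)) (f (G + y)) (f (G + H + y))"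

lemma update_cell:
  assumes st: "fst s reg_free = free" "fst s reg_N = N" "fst s reg_H = H"
    and k: "k < K" "fst s reg_o = k * N" and z: "z < N" "fst s reg_z = z"
    and i: "i \<notin> I" "finite I" "J = {i' \<in> I. cl i' \<noteq> cl i}"
    and R: "fst s reg_G = G" "fst s reg_F = F" "fst s reg_Q = Q" "fst s reg_pow = 2 ^ i"
      "fst s reg_cp = pc (cl i)"
    and t: "table (snd s) i z"
    and G: "\<forall>y<H. layer (snd s) G I y" and F: "\<forall>y<H. layer (snd s) F J y"
  shows "wp update_cell (\<lambda>t s'. t \<le> 200 \<and>
     (\<forall>x. x \<notin> {reg_x, reg_y, reg_v, reg_w, reg_u, reg_d} \<longrightarrow> fst s' x = fst s x) \<and>
     (\<forall>a. a \<noteq> Q + (k * N + N + z) \<and> a \<noteq> Q + H + (k * N + N + z) \<longrightarrow> snd s' a = snd s a) \<and>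
     layer (snd s') Q (insert i I) (k * N + N + z)) s"
proof -
  define x where "x = k * N + set_encode (set_decode z - A i)"
  define y where "y = k * N + N + z"
  define w where "w = sum pe (set_decode z \<inter> A i)"
  have f: "finite (set_decode z - A i)" by simp
  have "set_encode (set_decode z - A i) < N"
    by (rule set_encode_less) (use set_decode_subset[OF z(1)] in blast)
  then have x: "x div N = k" "x mod N = set_encode (set_decode z - A i)"
    by (simp_all add: x_def)
  have N0: "N \<noteq> 0" by simp
  have y': "y = Suc k * N + z" by (simp add: y_def)
  have y: "y div N = Suc k" "y mod N = z"
    unfolding y' using z(1) by (simp_all only: div_mult_self3[OF N0] mod_mult_self3 div_less mod_less add_0_right)
  have "Suc k * N \<le> K * N" using k by (intro mult_right_mono) auto
  then have yH: "y < H" "x < H"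
    using z(1) \<open>set_encode (set_decode z - A i) < N\<close> by (simp_all add: y_def x_def H_def)
  \<comment> \<open>This separates the value cell \<open>Q + y\<close> from the mask cell
    \<open>Q + H + y\<close>.\<close>
  have H: "H \<noteq> 0" by (simp add: H_def)
  have L: "snd s (free + z) = set_encode (set_decode z - A i)" "snd s (free + N + z) = w"
    using t by (simp_all add: table_def w_def)
  \<comment> \<open>\<open>p3\<close> and \<open>p4\<close> are the pairs of value and mask held
    after the first and the second comparison.\<close>
  define p3 where "p3 = (if snd s (G + y) < snd s (G + x) + w
    then (snd s (G + x) + w, snd s (G + H + x) + 2 ^ i) else (snd s (G + y), snd s (G + H + y)))"
  define p4 where "p4 = (if fst p3 < snd s (F + x) + w + pc (cl i)
    then (snd s (F + x) + w + pc (cl i), snd s (F + H + x) + 2 ^ i) else p3)"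
  have "optimal (insert i I) (Suc k) (set_decode z) (fst p4) (snd p4)"
  proof (rule optimal_insert[where ?v3.0 = "fst p3" and ?x3.0 = "snd p3" and w = w])
    show "(fst p3, snd p3) = (if snd s (G + y) < snd s (G + x) + w
      then (snd s (G + x) + w, snd s (G + H + x) + 2 ^ i) else (snd s (G + y), snd s (G + H + y)))"
      by (simp add: p3_def)
    show "(fst p4, snd p4) = (if fst p3 < snd s (F + x) + w + pc (cl i)
      then (snd s (F + x) + w + pc (cl i), snd s (F + H + x) + 2 ^ i) else (fst p3, snd p3))"
      by (simp add: p4_def)
    show "optimal I (Suc k) (set_decode z) (snd s (G + y)) (snd s (G + H + y))"
      using G yH y by (auto simp: layer_def)
    show "optimal I k (set_decode z - A i) (snd s (G + x)) (snd s (G + H + x))"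
      using G yH x by (auto simp: layer_def)
    show "optimal J k (set_decode z - A i) (snd s (F + x)) (snd s (F + H + x))"
      using F yH x by (auto simp: layer_def)
  qed (use i in \<open>simp_all add: w_def\<close>)
  then have *: "optimal (insert i I) (y div N) (set_decode (y mod N)) (fst p4) (snd p4)"
    using y by simp
  have yy: "k * N + N + z = y" by (simp add: y_def)
  have xx: "k * N + set_encode (set_decode z - A i) = x" by (simp add: x_def)
  show ?thesis
    unfolding update_cell_def yy layer_def
    using * H by (simp add: st k z R L yy xx p3_def p4_def split: if_splits)
qed


lemma wp_cells:
  assumes st: "static s" and k: "k < K" "fst s reg_o = k * N"
    and i: "i \<notin> I" "finite I" "J = {i' \<in> I. cl i' \<noteq> cl i}"
    and R: "fst s reg_G = G" "fst s reg_F = F" "fst s reg_Q = Q" "fst s reg_pow = 2 ^ i"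
      "fst s reg_cp = pc (cl i)"
    and le: "free + N + N \<le> F" "free + N + N \<le> G" "F + H + H \<le> Q" "G + H + H \<le> Q"
    and t: "\<forall>z<N. table (snd s) i z"
    and G: "\<forall>y<H. layer (snd s) G I y" and F: "\<forall>y<H. layer (snd s) F J y"
    and Q: "\<forall>y<k * N + N. layer (snd s) Q (insert i I) y"
  shows "wp (For reg_z reg_N update_cell) (\<lambda>t s'. t \<le> N * 250 \<and>
     (\<forall>x. x \<notin> {reg_z, reg_x, reg_y, reg_v, reg_w, reg_u, reg_d} \<longrightarrow> fst s' x = fst s x) \<and>
     (\<forall>a. a < Q \<or> Q + H + H \<le> a \<longrightarrow> snd s' a = snd s a) \<and>
     (\<forall>y<k * N + N + N. layer (snd s') Q (insert i I) y)) s"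
proof -
  let ?I = "\<lambda>z s'.
     (\<forall>x. x \<notin> {reg_z, reg_x, reg_y, reg_v, reg_w, reg_u, reg_d} \<longrightarrow> fst s' x = fst s x) \<and>
     (\<forall>a. a < Q \<or> Q + H + H \<le> a \<longrightarrow> snd s' a = snd s a) \<and>
     (\<forall>y<k * N + N + z. layer (snd s') Q (insert i I) y)"
  have T: "6 + N * (208 + 8) \<le> N * 250"
  proof -
    have "6 + a * 216 \<le> a * 250" if "1 \<le> a" for a :: nat
      using that by linarith
    from this[of N] show ?thesis by simp
  qed
  \<comment> \<open>Row \<open>k + 1\<close> ends within the first \<open>H\<close> cells, so values
    never reach the masks stored at \<open>Q + H\<close>.\<close>
  have "Suc k * N \<le> K * N" using k by (intro mult_right_mono) auto
  then have kH: "k * N + N + N \<le> H" by (simp add: H_def)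
  show ?thesis
  proof (rule wp_For[where I = ?I and b = N and B = 208])
    fix z s' assume z: "z < N" "fst s' reg_z = z" and I: "?I z s'" and N: "fst s' reg_N = N"
    have u: "wp update_cell (\<lambda>t s''. t \<le> 200 \<and>
     (\<forall>x. x \<notin> {reg_x, reg_y, reg_v, reg_w, reg_u, reg_d} \<longrightarrow> fst s'' x = fst s' x) \<and>
     (\<forall>a. a \<noteq> Q + (k * N + N + z) \<and> a \<noteq> Q + H + (k * N + N + z) \<longrightarrow> snd s'' a = snd s' a) \<and>
     layer (snd s'') Q (insert i I) (k * N + N + z)) s'"
    proof (rule update_cell)
      show "fst s' reg_free = free" "fst s' reg_N = N" "fst s' reg_H = H" "fst s' reg_o = k * N"
        "fst s' reg_G = G" "fst s' reg_F = F" "fst s' reg_Q = Q" "fst s' reg_pow = 2 ^ i"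
        "fst s' reg_cp = pc (cl i)"
        using I k R st by (simp_all add: static_def)
      have mem: "snd s' a = snd s a" if "a < Q" for a using I that by simp
      show "table (snd s') i z"
        using t z(1) le by (simp add: table_def mem)
      show "\<forall>y<H. layer (snd s') G I y" "\<forall>y<H. layer (snd s') F J y"
        using G F le by (simp_all add: layer_def mem)
    qed (use z k i in auto)
    show "wp update_cell (\<lambda>t s''. t \<le> 208 \<and> fst s'' reg_z = z \<and> fst s'' reg_N = N \<and>
       ?I (Suc z) ((fst s'')(reg_z := Suc z), snd s'')) s'"
    proof (rule wp_mono[OF u], elim conjE, intro conjI)
      fix t and s'' :: state
      assume mem: "\<forall>a. a \<noteq> Q + (k * N + N + z) \<and> a \<noteq> Q + H + (k * N + N + z) \<longrightarrow> snd s'' a = snd s' a"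
        and new: "layer (snd s'') Q (insert i I) (k * N + N + z)"
      have "layer (snd s'') Q (insert i I) y" if "y < k * N + N + z" for y
      proof -
        have "y < H" using that kH z(1) by simp
        then have "snd s'' (Q + y) = snd s' (Q + y)" "snd s'' (Q + H + y) = snd s' (Q + H + y)"
          using mem that kH z(1) by auto
        moreover have "layer (snd s') Q (insert i I) y" using I that by blast
        ultimately show ?thesis by (simp add: layer_def)
      qed
      then show "\<forall>y<k * N + N + Suc z. layer (snd ((fst s'')(reg_z := Suc z), snd s'')) Q (insert i I) y"
        using new by (auto simp: less_Suc_eq)
      show "\<forall>a. a < Q \<or> Q + H + H \<le> a \<longrightarrow> snd ((fst s'')(reg_z := Suc z), snd s'') a = snd s a"
        using mem I kH z(1) by auto
    qed (use z N I in auto)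
  qed (use assms T in \<open>auto simp: static_def\<close>)
qed

lemma make_layer:
  assumes st: "static s"
    and i: "i \<notin> I" "finite I" "J = {i' \<in> I. cl i' \<noteq> cl i}"
    and R: "fst s reg_G = G" "fst s reg_F = F" "fst s reg_Q = Q" "fst s reg_pow = 2 ^ i"
      "fst s reg_cp = pc (cl i)"
    and le: "free + N + N \<le> F" "free + N + N \<le> G" "F + H + H \<le> Q" "G + H + H \<le> Q"
    and t: "\<forall>z<N. table (snd s) i z"
    and G: "\<forall>y<H. layer (snd s) G I y" and F: "\<forall>y<H. layer (snd s) F J y"
    and Q: "\<forall>a\<ge>Q. snd s a = 0"
  shows "wp make_layer (\<lambda>t s'. t \<le> (K + 1) * (N * 300) \<and>
     (\<forall>x. x \<notin> {reg_k, reg_o, reg_z, reg_x, reg_y, reg_v, reg_w, reg_u, reg_d} \<longrightarrow> fst s' x = fst s x) \<and>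
     (\<forall>a. a < Q \<or> Q + H + H \<le> a \<longrightarrow> snd s' a = snd s a) \<and>
     (\<forall>y<H. layer (snd s') Q (insert i I) y)) s"
proof -
  let ?I = "\<lambda>k s'. fst s' reg_o = k * N \<and>
     (\<forall>x. x \<notin> {reg_k, reg_o, reg_z, reg_x, reg_y, reg_v, reg_w, reg_u, reg_d} \<longrightarrow> fst s' x = fst s x) \<and>
     (\<forall>a. a < Q \<or> Q + H + H \<le> a \<longrightarrow> snd s' a = snd s a) \<and>
     (\<forall>y<k * N + N. layer (snd s') Q (insert i I) y)"
  have "1 \<le> N" by simp
  have T: "6 + K * (N * 250 + 10 + 8) + 10 \<le> (K + 1) * (N * 300)"
    using mult_le_mono2[OF \<open>1 \<le> N\<close>, of K] \<open>1 \<le> N\<close> unfolding distrib_left distrib_right by linarith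
  \<comment> \<open>Row 0 admits only the empty collection, whose value and mask are the zeros
    already in memory.\<close>
  have 0: "layer (snd s) Q (insert i I) y" if "y < N" for y
    using that Q i(2) by (simp add: layer_def optimal_0)
  have "wp (For reg_k reg_K (For reg_z reg_N update_cell ;; reg_o ::= Reg reg_o \<oplus> Reg reg_N))
     (\<lambda>t s'. t + 10 \<le> (K + 1) * (N * 300) \<and> ?I K s') ((fst s)(reg_o := 0), snd s)"
  proof (rule wp_For[where I = ?I and b = K and B = "N * 250 + 10" and T = "6 + K * (N * 250 + 10 + 8)"])
    fix k s' assume k: "k < K" "fst s' reg_k = k" and I: "?I k s'" and K: "fst s' reg_K = K"
    have mem: "snd s' a = snd s a" if "a < Q" for a using I that by simp
    have fQ: "free \<le> Q" using le by simp
    have st': "static s'"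
      by (rule static_cong[OF st]) (use I fQ in auto)
    have u: "wp (For reg_z reg_N update_cell) (\<lambda>t s''. t \<le> N * 250 \<and>
     (\<forall>x. x \<notin> {reg_z, reg_x, reg_y, reg_v, reg_w, reg_u, reg_d} \<longrightarrow> fst s'' x = fst s' x) \<and>
     (\<forall>a. a < Q \<or> Q + H + H \<le> a \<longrightarrow> snd s'' a = snd s' a) \<and>
     (\<forall>y<k * N + N + N. layer (snd s'') Q (insert i I) y)) s'"
    proof (rule wp_cells[OF st' k(1)])
      show "\<forall>z<N. table (snd s') i z"
        using t le by (simp add: table_def mem)
      show "\<forall>y<H. layer (snd s') G I y" "\<forall>y<H. layer (snd s') F J y"
        using G F le by (simp_all add: layer_def mem)
    qed (use I R i le in auto)
    show "wp (For reg_z reg_N update_cell ;; reg_o ::= Reg reg_o \<oplus> Reg reg_N)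
      (\<lambda>t s''. t \<le> N * 250 + 10 \<and> fst s'' reg_k = k \<and> fst s'' reg_K = K \<and>
       ?I (Suc k) ((fst s'')(reg_k := Suc k), snd s'')) s'"
      unfolding wp_Seq
      by (rule wp_mono[OF u]) (use I k K st' in \<open>auto simp: static_def algebra_simps\<close>)
  qed (use assms T 0 in \<open>auto simp: static_def H_def\<close>)
  then show ?thesis unfolding make_layer_def
    by (auto simp: H_def elim!: wp_mono)
qed

end

section \<open>The complete program\<close>

text \<open>The sets of a class need not be contiguous, so all sets are scanned for every class.
  \<open>reg_cell\<close> runs through the class matrix without ever being reset, and
  \<open>reg_pow\<close> doubles for skipped sets too, so digits of the mask are global
  indices.\<close>

definition process_set :: com where
  "process_set =
     Cond (Equal (Load (Reg reg_cell)) (Const 1))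
       (make_tables ;; make_layer ;;
        reg_G ::= Reg reg_Q ;;
        reg_Q ::= Reg reg_Q \<oplus> Reg reg_H \<oplus> Reg reg_H) Skip ;;
     reg_cell ::= Reg reg_cell \<oplus> Const 1 ;;
     reg_row ::= Reg reg_row \<oplus> Reg reg_n ;;
     reg_pow ::= Reg reg_pow \<oplus> Reg reg_pow"

definition process_class :: com where
  "process_class =
     reg_F ::= Reg reg_G ;;
     reg_cp ::= Load (Const 4 \<oplus> Reg reg_n \<oplus> Reg reg_j) ;;
     reg_row ::= Reg reg_sets ;;
     reg_pow ::= Const 1 ;;
     For reg_i reg_m process_set"

definition process_all :: com where
  "process_all =
     reg_G ::= Reg reg_free \<oplus> Reg reg_N \<oplus> Reg reg_N ;;
     reg_Q ::= Reg reg_G \<oplus> Reg reg_H \<oplus> Reg reg_H ;;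
     reg_cell ::= Reg reg_classes ;;
     For reg_j reg_l process_class"

text \<open>
  Without division the mask has to be read from its top digit: after each doubling this digit is
  the comparison with \<open>2 ^ m\<close>.
\<close>

definition read_bit :: com where
  "read_bit =
     reg_w ::= Reg reg_w \<oplus> Reg reg_w ;;
     Cond (Less (Reg reg_w) (Reg reg_top))
      (Store (Reg reg_m \<ominus> Reg reg_i \<ominus> Const 1) (Const 0))
      (reg_w ::= Reg reg_w \<ominus> Reg reg_top ;;
       Store (Reg reg_m \<ominus> Reg reg_i \<ominus> Const 1) (Const 1))"

text \<open>The last cell of the latest layer is the mask for \<open>k = K\<close> and
  \<open>z = N - 1\<close>, the whole universe.\<close>

definition read_out :: com where
  "read_out =
     reg_w ::= Load (Reg reg_G \<oplus> Reg reg_H \<oplus> Reg reg_H \<ominus> Const 1) ;;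
     For reg_i reg_m read_bit"

text \<open>Products come from repeated addition and powers from repeated doubling. The number
  \<open>2 ^ m\<close> serves only to read the answer; no table has that length.\<close>

definition set_registers :: com where
  "set_registers =
     reg_sets ::= Const 4 \<oplus> Reg reg_n \<oplus> Reg reg_l ;;
     reg_classes ::= Reg reg_sets ;;
     For reg_i reg_m (reg_classes ::= Reg reg_classes \<oplus> Reg reg_n) ;;
     reg_top ::= Const 1 ;;
     For reg_i reg_m (reg_top ::= Reg reg_top \<oplus> Reg reg_top) ;;
     reg_free ::= Reg reg_classes ;;
     For reg_i reg_l (reg_free ::= Reg reg_free \<oplus> Reg reg_m) ;;
     reg_N ::= Const 1 ;;
     For reg_i reg_n (reg_N ::= Reg reg_N \<oplus> Reg reg_N) ;;
     reg_H ::= Reg reg_N ;;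
     For reg_i reg_K (reg_H ::= Reg reg_H \<oplus> Reg reg_N)"

text \<open>A collection has at most \<open>m\<close> sets, so capping \<open>K\<close> at
  \<open>m\<close> loses nothing, and it makes the number of rows independent of the size of the
  given bound.\<close>

definition set_up :: com where
  "set_up =
     reg_n ::= Load (Const 0) ;;
     reg_m ::= Load (Const 1) ;;
     reg_l ::= Load (Const 2) ;;
     reg_K ::= Load (Const 3) ;;
     Cond (Less (Reg reg_m) (Reg reg_K)) (reg_K ::= Reg reg_m) Skip ;;
     set_registers"

lemma wp_add_loop:
  assumes "x \<noteq> y" "x \<noteq> r" "x \<noteq> i" "y \<noteq> i" "r \<noteq> i"
    and "\<And>t. t \<le> 6 + fst s r * 12 \<Longrightarrow>
      Q t ((fst s)(x := fst s x + fst s r * fst s y, i := fst s r), snd s)"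
  shows "wp (For i r (x ::= Reg x \<oplus> Reg y)) Q s"
  by (rule wp_For[where B = 4 and b = "fst s r" and
        I = "\<lambda>k s'. s' = ((fst s)(x := fst s x + k * fst s y, i := k), snd s)"])
    (use assms in \<open>auto simp: fun_upd_twist algebra_simps\<close>)

lemma wp_double_loop:
  assumes "x \<noteq> r" "x \<noteq> i" "r \<noteq> i"
    and "\<And>t. t \<le> 6 + fst s r * 12 \<Longrightarrow>
      Q t ((fst s)(x := fst s x * 2 ^ fst s r, i := fst s r), snd s)"
  shows "wp (For i r (x ::= Reg x \<oplus> Reg x)) Q s"
  by (rule wp_For[where B = 4 and b = "fst s r" and
        I = "\<lambda>k s'. s' = ((fst s)(x := fst s x * 2 ^ k, i := k), snd s)"])
    (use assms in \<open>auto simp: fun_upd_twist algebra_simps\<close>)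

context indexed_mpc
begin

lemma set_registers:
  assumes "is_input (snd s)" "fst s reg_n = n" "fst s reg_m = m" "fst s reg_l = l" "fst s reg_K = K"
  shows "wp set_registers (\<lambda>t s'. t \<le> 150 + (n + m + m + l + K) * 12 \<and> static s' \<and> snd s' = snd s) s"
  unfolding set_registers_def
  apply (simp add: assms(2-5))
  apply (rule wp_add_loop; simp add: assms(2-5))
  apply (rule wp_double_loop; simp add: assms(2-5))
  apply (rule wp_add_loop; simp add: assms(2-5))
  apply (rule wp_double_loop; simp add: assms(2-5))
  apply (rule wp_add_loop; simp add: assms(2-5))
  using assms by (simp add: static_def free_def H_def algebra_simps)

lemma set_up:
  assumes "is_input f" "f 0 = n" "f 1 = m" "f 2 = l" "f 3 = k" "K = min k m"
  shows "wp set_up (\<lambda>t s'. t \<le> 200 + (n + m + m + l + K) * 12 \<and> static s' \<and> snd s' = f) (r, f)"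
proof -
  define r' where "r' = r(reg_n := n, reg_m := m, reg_l := l, reg_K := K)"
  have "wp set_registers (\<lambda>t s'. t \<le> 150 + (n + m + m + l + K) * 12 \<and> static s' \<and> snd s' = snd (r', f)) (r', f)"
    by (rule set_registers) (use assms in \<open>auto simp: r'_def\<close>)
  then have w: "wp set_registers (\<lambda>t s'. t + 30 \<le> 200 + (n + m + m + l + K) * 12 \<and> static s' \<and> snd s' = f) (r', f)"
    by (rule wp_mono) auto
  show ?thesis
  proof (cases "m < k")
    case True
    then have r: "r' = r(reg_n := n, reg_m := m, reg_l := l, reg_K := m)"
      using assms(6) by (simp add: r'_def min_def)
    show ?thesis using True w unfolding set_up_def r
      by (simp add: assms(2-5) assms(3)[unfolded One_nat_def]) (erule wp_mono, simp)
  next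
    case False
    then have r: "r' = r(reg_n := n, reg_m := m, reg_l := l, reg_K := k)"
      using assms(6) by (simp add: r'_def min_def)
    show ?thesis using False w unfolding set_up_def r
      by (simp add: assms(2-5) assms(3)[unfolded One_nat_def]) (erule wp_mono, simp)
  qed
qed

text \<open>These are the initial segments of the lexicographic order by class and index. Within
  class \<open>j\<close>, the sets of \<open>treated j i\<close> outside the class form
  \<open>treated j 0\<close>, which is the \<open>J\<close> of the recursion.\<close>

definition treated :: "nat \<Rightarrow> nat \<Rightarrow> nat set" where
  "treated j i = {i'. i' < m \<and> (cl i' < j \<or> cl i' = j \<and> i' < i)}"

lemma finite_treated [simp]: "finite (treated j i)"
  by (simp add: treated_def)

lemma treated_Suc: "i < m \<Longrightarrow> treated j (Suc i) = (if cl i = j then insert i (treated j i) else treated j i)"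
  by (auto simp: treated_def less_Suc_eq)

lemma treated_m: "treated j m = treated (Suc j) 0"
  by (auto simp: treated_def less_Suc_eq)

lemma treated_0_0: "treated 0 0 = {}"
  by (simp add: treated_def)

lemma treated_l: "treated l 0 = {..<m}"
  using cl_less by (auto simp: treated_def)

definition layered :: "nat set \<Rightarrow> state \<Rightarrow> bool" where
  "layered I s \<longleftrightarrow> static s \<and> free + N + N \<le> fst s reg_G \<and> fst s reg_G + H + H \<le> fst s reg_Q \<and>
     (\<forall>a\<ge>fst s reg_Q. snd s a = 0) \<and> (\<forall>y<H. layer (snd s) (fst s reg_G) I y)"

text \<open>The layers at \<open>reg_F\<close> and \<open>reg_G\<close> may coincide, as they do at
  the start of a class; what matters is that both end before \<open>reg_Q\<close>.\<close>

definition in_class :: "nat \<Rightarrow> nat \<Rightarrow> state \<Rightarrow> bool" where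
  "in_class j i s \<longleftrightarrow> layered (treated j i) s \<and>
     free + N + N \<le> fst s reg_F \<and> fst s reg_F + H + H \<le> fst s reg_Q \<and>
     (\<forall>y<H. layer (snd s) (fst s reg_F) (treated j 0) y) \<and>
     fst s reg_cell = 4 + n + l + m * n + j * m + i \<and> fst s reg_row = 4 + n + l + i * n \<and>
     fst s reg_pow = 2 ^ i \<and> fst s reg_cp = pc j"

definition set_time :: nat where
  "set_time = 60 + (n + 1) * (N * 150) + (K + 1) * (N * 300)"

text \<open>The invariant ties all pointers to \<open>i\<close>, so it is stated for the state after
  the pending updates of \<open>reg_cell\<close>, \<open>reg_row\<close>, \<open>reg_pow\<close> and
  the loop counter.\<close>

lemma add_set:
  assumes inv: "in_class j i s" and j: "j < l" and i: "i < m" and cl: "cl i = j"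
    and r: "fst s reg_j = j" "fst s reg_i = i"
  shows "wp (make_tables ;; make_layer ;;
        reg_G ::= Reg reg_Q ;;
        reg_Q ::= Reg reg_Q \<oplus> Reg reg_H \<oplus> Reg reg_H)
    (\<lambda>t s'. t + 40 \<le> set_time \<and> fst s' reg_j = j \<and> fst s' reg_i = i \<and> fst s' reg_n = n \<and>
      in_class j (Suc i) ((fst s')(reg_cell := Suc (fst s' reg_cell), reg_row := fst s' reg_row + n,
        reg_pow := 2 * fst s' reg_pow, reg_i := Suc i), snd s')) s"
proof -
  note inv' = inv[unfolded in_class_def layered_def]
  define G F Q where "G = fst s reg_G" and "F = fst s reg_F" and "Q = fst s reg_Q"
  have Q: "free + N + N \<le> Q" using inv' by (simp add: Q_def)
  have st: "static s" using inv' by simp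
  have T: "i \<notin> treated j i" "treated j 0 = {i' \<in> treated j i. cl i' \<noteq> cl i}"
    using cl by (auto simp: treated_def)
  have "wp make_tables (\<lambda>t s'. t \<le> (n + 1) * (N * 150) \<and>
     (\<forall>x. x \<notin> {reg_e, reg_z, reg_p, reg_x, reg_y} \<longrightarrow> fst s' x = fst s x) \<and>
     (\<forall>a. a < free \<or> free + N + N \<le> a \<longrightarrow> snd s' a = snd s a) \<and>
     (\<forall>z<N. table (snd s') i z)) s"
    by (rule make_tables) (use inv' i in auto)
  then show ?thesis unfolding wp_Seq[of make_tables]
  proof (rule wp_mono, elim conjE)
    fix t1 and s1 :: state
    assume t1: "t1 \<le> (n + 1) * (N * 150)"
      and r1: "\<forall>x. x \<notin> {reg_e, reg_z, reg_p, reg_x, reg_y} \<longrightarrow> fst s1 x = fst s x"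
      and m1: "\<forall>a. a < free \<or> free + N + N \<le> a \<longrightarrow> snd s1 a = snd s a"
      and tab: "\<forall>z<N. table (snd s1) i z"
    have st1: "static s1" by (rule static_cong[OF st]) (use r1 m1 in auto)
    \<comment> \<open>The tables end where the first layer begins, so rewriting them leaves every
      layer intact.\<close>
    have L1: "layer (snd s1) B I y = layer (snd s) B I y" if "free + N + N \<le> B" for B I y
      using m1 that by (simp add: layer_def)
    have "wp make_layer (\<lambda>t s'. t \<le> (K + 1) * (N * 300) \<and>
     (\<forall>x. x \<notin> {reg_k, reg_o, reg_z, reg_x, reg_y, reg_v, reg_w, reg_u, reg_d} \<longrightarrow> fst s' x = fst s1 x) \<and>
     (\<forall>a. a < Q \<or> Q + H + H \<le> a \<longrightarrow> snd s' a = snd s1 a) \<and>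
     (\<forall>y<H. layer (snd s') Q (insert i (treated j i)) y)) s1"
      by (rule make_layer[where F = F and G = G and J = "treated j 0"])
        (use st1 T inv' r1 m1 tab Q cl in \<open>auto simp: L1 G_def F_def Q_def\<close>)
    then show "wp (make_layer ;; reg_G ::= Reg reg_Q ;; reg_Q ::= Reg reg_Q \<oplus> Reg reg_H \<oplus> Reg reg_H)
      (\<lambda>t s'. t1 + t + 40 \<le> set_time \<and> fst s' reg_j = j \<and> fst s' reg_i = i \<and> fst s' reg_n = n \<and>
      in_class j (Suc i) ((fst s')(reg_cell := Suc (fst s' reg_cell), reg_row := fst s' reg_row + n,
        reg_pow := 2 * fst s' reg_pow, reg_i := Suc i), snd s')) s1"
      unfolding wp_Seq[of make_layer]
    proof (rule wp_mono, elim conjE)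
      fix t2 and s2 :: state
      assume t2: "t2 \<le> (K + 1) * (N * 300)"
        and r2: "\<forall>x. x \<notin> {reg_k, reg_o, reg_z, reg_x, reg_y, reg_v, reg_w, reg_u, reg_d} \<longrightarrow> fst s2 x = fst s1 x"
        and m2: "\<forall>a. a < Q \<or> Q + H + H \<le> a \<longrightarrow> snd s2 a = snd s1 a"
        and new: "\<forall>y<H. layer (snd s2) Q (insert i (treated j i)) y"
      have st2: "static s2" by (rule static_cong[OF st1]) (use r2 m2 Q in auto)
      have L2: "layer (snd s2) F (treated j 0) y" if "y < H" for y
      proof -
        have "layer (snd s) F (treated j 0) y" "free + N + N \<le> F" "F + H + H \<le> Q"
          using inv' that by (simp_all add: F_def Q_def)
        then show ?thesis using m2 that L1[of F] by (simp add: layer_def)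
      qed
      \<comment> \<open>The excluded registers are the inner counters, the table length (12 to 15)
        and the scratch registers (23 to 29).\<close>
      have reg: "fst s2 x = fst s x" if "x \<in> {0..11} \<union> {16..22}" for x
        using r1 r2 that by auto
      have "static ((fst s2)(reg_G := a, reg_Q := b, reg_cell := c, reg_row := d, reg_pow := e, reg_i := g), snd s2)"
        for a b c d e g by (rule static_cong[OF st2]) auto
      moreover have "\<forall>a\<ge>Q + H + H. snd s2 a = 0" using inv' m1 m2 Q by (auto simp: Q_def)
      ultimately show "wp (reg_G ::= Reg reg_Q ;; reg_Q ::= Reg reg_Q \<oplus> Reg reg_H \<oplus> Reg reg_H)
      (\<lambda>t s'. t1 + (t2 + t) + 40 \<le> set_time \<and> fst s' reg_j = j \<and> fst s' reg_i = i \<and> fst s' reg_n = n \<and>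
      in_class j (Suc i) ((fst s')(reg_cell := Suc (fst s' reg_cell), reg_row := fst s' reg_row + n,
        reg_pow := 2 * fst s' reg_pow, reg_i := Suc i), snd s')) s2"
        using inv' r t1 t2 new L2 Q st2 T cl i
        by (simp add: reg in_class_def layered_def treated_Suc set_time_def static_def
            G_def[symmetric] F_def[symmetric] Q_def[symmetric])
    qed
  qed
qed

lemma process_set:
  assumes inv: "in_class j i s" and j: "j < l" and i: "i < m"
    and r: "fst s reg_j = j" "fst s reg_i = i"
  shows "wp process_set
    (\<lambda>t s'. t \<le> set_time \<and> fst s' reg_j = j \<and> fst s' reg_i = i \<and>
      in_class j (Suc i) ((fst s')(reg_i := Suc i), snd s')) s"
proof -
  have st: "static s" using inv by (simp add: in_class_def layered_def)
  have cell: "snd s (fst s reg_cell) = of_bool (cl i = j)"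
    using inv st i j by (simp add: in_class_def static_def is_input_def)
  show ?thesis
  proof (cases "cl i = j")
    case True
    have "fst s reg_n = n" using st by (simp add: static_def)
    then show ?thesis
      using add_set[OF inv j i True r] cell True unfolding process_set_def wp_Seq[of "Cond _ _ _"]
      by (simp del: wp_Seq) (erule wp_mono, simp add: fun_upd_twist mult_2)
  next
    case False
    have "static ((fst s)(reg_cell := c, reg_row := d, reg_pow := e, reg_i := g), snd s)"
      for c d e g by (rule static_cong[OF st]) auto
    with False show ?thesis
      using inv cell r st i unfolding process_set_def
      by (simp add: in_class_def layered_def treated_Suc set_time_def static_def[of s])
  qed
qed


lemma static_upd: "static s \<Longrightarrow> 10 \<le> x \<Longrightarrow> static ((fst s)(x := a), snd s)"
  by (rule static_cong) auto

definition class_time :: nat where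
  "class_time = 30 + m * (set_time + 8)"

lemma process_class:
  assumes L: "layered (treated j 0) s" and j: "j < l" "fst s reg_j = j"
    and cell: "fst s reg_cell = 4 + n + l + m * n + j * m"
  shows "wp process_class (\<lambda>t s'. t \<le> class_time \<and> fst s' reg_j = j \<and>
      layered (treated (Suc j) 0) s' \<and> fst s' reg_cell = 4 + n + l + m * n + Suc j * m) s"
proof -
  have st: "static s" using L by (simp add: layered_def)
  have cp: "snd s (4 + n + j) = pc j" using st j by (simp add: static_def is_input_def)
  let ?s = "((fst s)(reg_F := fst s reg_G, reg_cp := pc j, reg_row := 4 + n + l, reg_pow := 1), snd s)"
  have st': "static ((fst s)(reg_F := a, reg_cp := b, reg_row := c, reg_pow := d, reg_i := e), snd s)"
    for a b c d e by (rule static_cong[OF st]) auto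
  let ?I = "\<lambda>i s'. in_class j i s' \<and> fst s' reg_j = j"
  have "wp (For reg_i reg_m process_set) (\<lambda>t s'. t + 20 \<le> class_time \<and> ?I m s') ?s"
  proof (rule wp_For[where I = ?I and b = m and B = set_time and T = "6 + m * (set_time + 8)"])
    fix i s' assume i: "i < m" "fst s' reg_i = i" and I: "?I i s'" and m: "fst s' reg_m = m"
    show "wp process_set (\<lambda>t s''. t \<le> set_time \<and> fst s'' reg_i = i \<and> fst s'' reg_m = m \<and>
      ?I (Suc i) ((fst s'')(reg_i := Suc i), snd s'')) s'"
      by (rule wp_mono[OF process_set[of j i]])
        (use i I j in \<open>auto simp: in_class_def layered_def static_def\<close>)
  qed (use L j st st' cell in \<open>auto simp: class_time_def in_class_def layered_def static_def[of s]\<close>)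
  then have "wp (For reg_i reg_m process_set) (\<lambda>t s'. t + 20 \<le> class_time \<and> fst s' reg_j = j \<and>
      layered (treated (Suc j) 0) s' \<and> fst s' reg_cell = 4 + n + l + m * n + Suc j * m) ?s"
    by (rule wp_mono) (auto simp: in_class_def treated_m)
  then show ?thesis
    using st cp j unfolding process_class_def
    by (simp add: static_def) (erule wp_mono, simp)
qed

definition all_time :: nat where
  "all_time = 40 + l * (class_time + 8)"

lemma process_all:
  assumes st: "static s" and Z: "\<forall>a\<ge>free. snd s a = 0"
  shows "wp process_all (\<lambda>t s'. t \<le> all_time \<and> layered {..<m} s') s"
proof -
  let ?G = "free + N + N"
  let ?s = "((fst s)(reg_G := ?G, reg_Q := ?G + H + H, reg_cell := 4 + n + l + m * n), snd s)"
  have st': "static ((fst s)(reg_G := a, reg_Q := b, reg_cell := c, reg_j := d), snd s)"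
    for a b c d by (rule static_cong[OF st]) auto
  \<comment> \<open>Zero memory is already the correct layer when no set has been treated.\<close>
  have L: "layer (snd s) ?G {} y" for y using Z by (simp add: layer_def optimal_empty)
  let ?I = "\<lambda>j s'. layered (treated j 0) s' \<and> fst s' reg_cell = 4 + n + l + m * n + j * m"
  have "wp (For reg_j reg_l process_class) (\<lambda>t s'. t + 30 \<le> all_time \<and> layered {..<m} s') ?s"
  proof (rule wp_For[where I = ?I and b = l and B = class_time and T = "6 + l * (class_time + 8)"])
    fix j s' assume j: "j < l" "fst s' reg_j = j" and I: "?I j s'" and l: "fst s' reg_l = l"
    show "wp process_class (\<lambda>t s''. t \<le> class_time \<and> fst s'' reg_j = j \<and> fst s'' reg_l = l \<and>
      ?I (Suc j) ((fst s'')(reg_j := Suc j), snd s'')) s'"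
      by (rule wp_mono[OF process_class[of j]])
        (use j I in \<open>auto simp: layered_def static_upd\<close>, simp add: static_def)
  qed (use st st' Z L in \<open>auto simp: all_time_def layered_def treated_0_0 treated_l static_def[of s]\<close>)
  then show ?thesis
    using st unfolding process_all_def
    by (simp add: static_def) (erule wp_mono, simp)
qed

lemma read_out:
  assumes "layered {..<m} s"
  shows "\<exists>C. C \<subseteq> {..<m} \<and> card C \<le> K \<and> (\<forall>C'. C' \<subseteq> {..<m} \<and> card C' \<le> K \<longrightarrow> val {..<n} C' \<le> val {..<n} C) \<and>
    wp read_out (\<lambda>t s'. t \<le> 40 + m * 50 \<and> (\<forall>i<m. snd s' i = of_bool (i \<in> C))) s"
proof -
  have st: "static s" using assms by (simp add: layered_def)
  have H: "H - 1 = K * N + (N - 1)" "1 \<le> H" by (simp_all add: H_def Suc_le_eq)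
  have N0: "N \<noteq> 0" and N1: "N - 1 < N" by simp_all
  have y: "(H - 1) div N = K" "(H - 1) mod N = N - 1"
    unfolding H(1) by (simp_all only: div_mult_self3[OF N0] mod_mult_self3 div_less mod_less N1 add_0_right)
  have "layer (snd s) (fst s reg_G) {..<m} (H - 1)"
    using assms H by (simp add: layered_def)
  then have o: "optimal {..<m} K {..<n} (snd s (fst s reg_G + (H - 1))) (snd s (fst s reg_G + H + (H - 1)))"
    unfolding layer_def y set_decode_power_minus_1 .
  then obtain C where C: "C \<subseteq> {..<m}" "card C \<le> K" "snd s (fst s reg_G + H + (H - 1)) = set_encode C"
      "snd s (fst s reg_G + (H - 1)) \<le> val {..<n} C"
    unfolding optimal_def candidate_def by blast
  have max: "\<forall>C'. C' \<subseteq> {..<m} \<and> card C' \<le> K \<longrightarrow> val {..<n} C' \<le> val {..<n} C"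
    using o C(4) unfolding optimal_def using order_trans by blast
  \<comment> \<open>After \<open>t\<close> rounds the top \<open>t\<close> digits are written out,
    and the remaining digits are shifted up by \<open>t\<close> places.\<close>
  let ?I = "\<lambda>t s'. fst s' reg_m = m \<and> fst s' reg_top = 2 ^ m \<and>
    fst s' reg_w = set_encode (C \<inter> {..<m - t}) * 2 ^ t \<and>
    (\<forall>i<m. m - t \<le> i \<longrightarrow> snd s' i = of_bool (i \<in> C))"
  have loop: "wp (For reg_i reg_m read_bit)
    (\<lambda>t s'. t + 20 \<le> 40 + m * 50 \<and> (\<forall>i<m. snd s' i = of_bool (i \<in> C)))
    ((fst s)(reg_w := set_encode C), snd s)"
  proof (rule wp_For[where I = ?I and b = m and B = 40 and T = "6 + m * (40 + 8)"])
    fix k and s' :: state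
    assume k: "k < m" "fst s' reg_i = k" and I: "?I k s'"
    define d where "d = m - k - 1"
    have d: "m - k = Suc d" "m - Suc k = d" "d + Suc k = m" using k by (simp_all add: d_def)
    have pm: "2 ^ d * (2 * 2 ^ k) = (2::nat) ^ m"
      using power_add[of "2::nat" d "Suc k"] unfolding d(3) by simp
    \<comment> \<open>The digits below \<open>d\<close> alone stay below \<open>2 ^ m\<close> after
      the shift, so the comparison with \<open>2 ^ m\<close> tests exactly the digit
      \<open>d\<close>.\<close>
    have le: "set_encode (C \<inter> {..<d}) < 2 ^ d" by (rule set_encode_less) auto
    have w: "fst s' reg_w = set_encode (C \<inter> {..<Suc d}) * 2 ^ k" using I d by simp
    have m: "\<forall>i<m. i \<noteq> d \<longrightarrow> d \<le> i \<longrightarrow> snd s' i = of_bool (i \<in> C)" using I d by auto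
    show "wp read_bit
      (\<lambda>t s''. t \<le> 40 \<and> fst s'' reg_i = k \<and> fst s'' reg_m = m \<and>
        ?I (Suc k) ((fst s'')(reg_i := Suc k), snd s'')) s'"
    proof (cases "d \<in> C")
      case True
      then have "C \<inter> {..<Suc d} = insert d (C \<inter> {..<d})" by auto
      then have "fst s' reg_w + fst s' reg_w = 2 ^ m + set_encode (C \<inter> {..<d}) * 2 ^ Suc k"
        unfolding w pm[symmetric] by (simp add: algebra_simps)
      then show ?thesis unfolding read_bit_def using I k True m d by simp
    next
      case False
      then have "C \<inter> {..<Suc d} = C \<inter> {..<d}" by (auto simp: less_Suc_eq)
      then have e: "fst s' reg_w + fst s' reg_w = set_encode (C \<inter> {..<d}) * 2 ^ Suc k"
        unfolding w by simp
      also have "\<dots> < 2 ^ d * 2 ^ Suc k" using le by simp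
      finally have "fst s' reg_w + fst s' reg_w < 2 ^ m" using pm by simp
      then show ?thesis unfolding read_bit_def using I k False m d e by simp
    qed
  qed (use st C(1) in \<open>auto simp: static_def Int_absorb2\<close>)
  have "fst s reg_G + H + H - Suc 0 = fst s reg_G + H + (H - 1)" using H(2) by simp
  then have "wp read_out (\<lambda>t s'. t \<le> 40 + m * 50 \<and> (\<forall>i<m. snd s' i = of_bool (i \<in> C))) s"
    using st C(3) loop unfolding read_out_def
    by (simp add: static_def del: wp_Cond) (erule wp_mono, simp)
  with C(1,2) max show ?thesis by blast
qed

end

definition mpc_program :: com where
  "mpc_program = (set_up ;; process_all) ;; read_out"

lemma (in indexed_mpc) mpc_program:
  assumes "is_input f" "f 0 = n" "f 1 = m" "f 2 = l" "f 3 = k" "K = min k m"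
    and "\<And>a. free \<le> a \<Longrightarrow> f a = 0"
  shows "\<exists>C. C \<subseteq> {..<m} \<and> card C \<le> K \<and> (\<forall>C'. C' \<subseteq> {..<m} \<and> card C' \<le> K \<longrightarrow> val {..<n} C' \<le> val {..<n} C) \<and>
    wp mpc_program (\<lambda>t s. t \<le> 240 + (n + m + m + l + K) * 12 + all_time + m * 50 \<and>
      (\<forall>i<m. snd s i = of_bool (i \<in> C))) (r, f)"
proof -
  have "wp (set_up ;; process_all)
    (\<lambda>t s. t \<le> 200 + (n + m + m + l + K) * 12 + all_time \<and> layered {..<m} s) (r, f)"
    unfolding wp_Seq
  proof (rule wp_mono[OF set_up[OF assms(1-6)]], elim conjE)
    fix t s assume "t \<le> 200 + (n + m + m + l + K) * 12" "static s" "snd s = f"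
    then show "wp process_all
      (\<lambda>t' s. t + t' \<le> 200 + (n + m + m + l + K) * 12 + all_time \<and> layered {..<m} s) s"
      by (intro wp_mono[OF process_all]) (use assms(7) in auto)
  qed
  \<comment> \<open>The run of the first two phases is fixed before \<open>C\<close> is chosen,
    because \<open>C\<close> is read off from its final state.\<close>
  then obtain t s where 1: "exec (set_up ;; process_all) (r, f) t s"
    "t \<le> 200 + (n + m + m + l + K) * 12 + all_time" "layered {..<m} s"
    by (elim wpE) blast
  obtain C where C: "C \<subseteq> {..<m}" "card C \<le> K"
    "\<forall>C'. C' \<subseteq> {..<m} \<and> card C' \<le> K \<longrightarrow> val {..<n} C' \<le> val {..<n} C"
    "wp read_out (\<lambda>t s'. t \<le> 40 + m * 50 \<and> (\<forall>i<m. snd s' i = of_bool (i \<in> C))) s"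
    using read_out[OF 1(3)] by blast
  have "wp mpc_program (\<lambda>t s. t \<le> 240 + (n + m + m + l + K) * 12 + all_time + m * 50 \<and>
      (\<forall>i<m. snd s i = of_bool (i \<in> C))) (r, f)"
    unfolding mpc_program_def wp_Seq[of "set_up ;; process_all"] wp_det[OF 1(1)]
    by (rule wp_mono[OF C(4)]) (use 1(2) in auto)
  with C(1-3) show ?thesis by blast
qed

text \<open>One set costs \<open>N * s\<close> up to a constant, for \<open>n\<close> doubling
  passes and \<open>K\<close> rows. Each of the \<open>l * m\<close> tests of the scan is charged
  this amount, whether or not the set lies in the class, hence the exponent 3.\<close>

lemma (in indexed_mpc) time_bound:
  assumes "1 \<le> s" "n \<le> s" "m \<le> s" "l \<le> s" "K \<le> s"
  shows "240 + (n + m + m + l + K) * 12 + all_time + m * 50 \<le> 2000 * (N * s ^ 3)"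
proof -
  define M where "M = N"
  have M: "1 \<le> M" by (simp add: M_def)
  have p: "s \<le> M * s" "1 \<le> M * s" "M * s \<le> M * (s * s)" "M * (s * s) \<le> M * (s * (s * s))"
    using M assms(1) by (simp_all add: Suc_le_eq)
  have "(n + 1) * (M * 150) \<le> (s + s) * (M * 150)" "(K + 1) * (M * 300) \<le> (s + s) * (M * 300)"
    using assms by (intro mult_right_mono; simp)+
  moreover have "(s + s) * (M * 150) = 300 * (M * s)" "(s + s) * (M * 300) = 600 * (M * s)"
    by simp_all
  ultimately have 1: "set_time \<le> 960 * (M * s)"
    unfolding set_time_def M_def[symmetric] using p(2) by linarith
  have "m * (set_time + 8) \<le> s * (960 * (M * s) + 8)"
    using assms 1 by (intro mult_mono) auto
  also have "\<dots> = 960 * (M * (s * s)) + 8 * s" by (simp add: algebra_simps)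
  finally have 2: "class_time \<le> 1000 * (M * (s * s))"
    unfolding class_time_def using p by linarith
  have "l * (class_time + 8) \<le> s * (1000 * (M * (s * s)) + 8)"
    using assms 2 by (intro mult_mono) auto
  also have "\<dots> = 1000 * (M * (s * (s * s))) + 8 * s" by (simp add: algebra_simps)
  finally have 3: "all_time \<le> 1050 * (M * (s * (s * s)))"
    unfolding all_time_def using p by linarith
  have "240 + (n + m + m + l + K) * 12 + m * 50 \<le> 240 + s * 110"
    using assms unfolding distrib_right by linarith
  also have "\<dots> \<le> 350 * (M * (s * (s * s)))" using p by linarith
  finally show ?thesis using 3 by (simp add: M_def power3_eq_cube mult.assoc)
qed

section \<open>Passage between the encoded instance and its indices\<close>

lemma nth_concat_rows:
  assumes "\<forall>xs\<in>set xss. length xs = b" "i < length xss" "j < b"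
  shows "concat xss ! (i * b + j) = xss ! i ! j"
  using assms
proof (induction xss arbitrary: i)
  case (Cons xs xss)
  then show ?case by (cases i) (auto simp: nth_append)
qed simp

lemma length_concat_rows: "\<forall>xs\<in>set xss. length xs = b \<Longrightarrow> length (concat xss) = length xss * b"
  by (induction xss) auto

theorem theorem1:
  "\<exists>(prog :: com) (c :: nat).
     \<forall>(U :: 'u set) S X (P :: 'u prices) K us ss xs.
       mpc_instance U S X K \<and> enumerates us U \<and> enumerates ss S \<and> enumerates xs X \<longrightarrow>
       (\<exists>t s C. exec prog (initial_state (mpc_encode us ss xs P K)) t s
          \<and> t \<le> mpc_time_bound c U S
          \<and> outputs s ss C
          \<and> mpc_solution S X P K C)"
proof (rule exI[of _ mpc_program], rule exI[of _ 2000], intro allI impI, elim conjE)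
  fix U :: "'u set" and S X and P :: "'u prices" and K us ss xs
  assume inst: "mpc_instance U S X K" and us: "enumerates us U" and ss: "enumerates ss S"
    and xs: "enumerates xs X"
  define n m l where "n = length us" and "m = length ss" and "l = length xs"
  define pe where "pe e = P (Inl (us ! e))" for e
  define pc where "pc j = P (Inr (xs ! j))" for j
  define A where "A i = {e. e < n \<and> us ! e \<in> ss ! i}" for i
  \<comment> \<open>That \<open>X\<close> covers \<open>S\<close> makes the choice possible,
    disjointness makes it unique, and nonempty classes later bound \<open>l\<close> by
    \<open>m\<close>.\<close>
  define cl where "cl i = (SOME j. j < l \<and> ss ! i \<in> xs ! j)" for i
  have part: "partition_on S X" and SU: "S \<subseteq> Pow U" using inst by (auto simp: mpc_instance_def)
  have bij: "bij_betw ((!) us) {..<n} U" "bij_betw ((!) ss) {..<m} S" "bij_betw ((!) xs) {..<l} X"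
    using us ss xs unfolding enumerates_def n_def m_def l_def by (auto intro!: bij_betw_nth)
  have cl_ex: "\<exists>j. j < l \<and> ss ! i \<in> xs ! j" if "i < m" for i
  proof -
    have "ss ! i \<in> \<Union>X"
      using partition_onD1[OF part] bij_betwE[OF bij(2)] that by auto
    then obtain Y where "Y \<in> X" "ss ! i \<in> Y" by blast
    then show ?thesis using bij_betw_imp_surj_on[OF bij(3)] by auto
  qed
  have cl: "cl i < l" "ss ! i \<in> xs ! cl i" if "i < m" for i
    using someI_ex[OF cl_ex[OF that]] by (simp_all add: cl_def)
  have cl_unique: "cl i = j \<longleftrightarrow> ss ! i \<in> xs ! j" if "i < m" "j < l" for i j
  proof
    assume "ss ! i \<in> xs ! j"
    then have "xs ! cl i \<inter> xs ! j \<noteq> {}" using cl(2)[OF that(1)] by blast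
    moreover have "xs ! cl i \<in> X" "xs ! j \<in> X"
      using bij_betwE[OF bij(3)] cl(1) that by auto
    ultimately have "xs ! cl i = xs ! j"
      using partition_onD2[OF part] by (auto dest: disjointD)
    then show "cl i = j"
      using bij_betw_imp_inj_on[OF bij(3)] cl(1) that by (auto dest: inj_onD)
  qed (use cl that in auto)
  interpret indexed_mpc n m l "min K m" pe pc A cl
    by unfold_locales (use cl in auto)

  define w where "w = mpc_encode us ss xs P K"
  define f where "f = snd (initial_state w)"
  have rows: "\<forall>r\<in>set (map (\<lambda>B. map (\<lambda>e. of_bool (e \<in> B) :: nat) us) ss). length r = n"
    "\<forall>r\<in>set (map (\<lambda>Y. map (\<lambda>B. of_bool (B \<in> Y) :: nat) ss) xs). length r = m"
    by (auto simp: n_def m_def)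
  have len: "length w = free"
    using length_concat_rows[OF rows(1)] length_concat_rows[OF rows(2)]
    by (simp add: w_def mpc_encode_def free_def flip: n_def m_def l_def)
  have f: "f a = w ! a" if "a < free" for a
    using that by (simp add: f_def initial_state_def len)
  have "\<exists>C. C \<subseteq> {..<m} \<and> card C \<le> min K m \<and>
    (\<forall>C'. C' \<subseteq> {..<m} \<and> card C' \<le> min K m \<longrightarrow> val {..<n} C' \<le> val {..<n} C) \<and>
    wp mpc_program (\<lambda>t s. t \<le> 240 + (n + m + m + l + min K m) * 12 + all_time + m * 50 \<and>
      (\<forall>i<m. snd s i = of_bool (i \<in> C))) (fst (initial_state w), f)"
  proof (rule mpc_program)
    show "f 0 = n" "f 1 = m" "f 2 = l" "f 3 = K"
      by (simp_all add: f free_def) (simp_all add: w_def mpc_encode_def n_def m_def l_def)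
    show "f a = 0" if "free \<le> a" for a
      using that by (simp add: f_def initial_state_def len)
    show "is_input f" unfolding is_input_def
    proof (intro conjI allI impI)
      fix e assume "e < n"
      then show "f (4 + e) = pe e"
        by (simp add: f free_def) (simp add: w_def mpc_encode_def nth_append n_def pe_def)
    next
      fix j assume "j < l"
      then show "f (4 + n + j) = pc j"
        by (simp add: f free_def) (simp add: w_def mpc_encode_def nth_append n_def l_def pc_def)
    next
      fix i e assume i: "i < m" "e < n"
      note b = row_index_less[OF i]
      have "f (4 + n + l + i * n + e) = w ! (4 + n + l + (i * n + e))"
        using b by (simp add: f free_def add.assoc)
      also have "\<dots> = concat (map (\<lambda>B. map (\<lambda>e. of_bool (e \<in> B)) us) ss) ! (i * n + e)"
        using b length_concat_rows[OF rows(1)]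
        by (simp add: w_def mpc_encode_def nth_append n_def l_def m_def)
      also have "\<dots> = of_bool (e \<in> A i)"
        using nth_concat_rows[OF rows(1), of i e] i by (simp add: A_def n_def m_def)
      finally show "f (4 + n + l + i * n + e) = of_bool (e \<in> A i)" .
    next
      fix j i assume j: "j < l" "i < m"
      note b = row_index_less[OF j]
      have "f (4 + n + l + m * n + j * m + i) = w ! (4 + n + l + m * n + (j * m + i))"
        using b by (simp add: f free_def add.assoc)
      also have "\<dots> = concat (map (\<lambda>Y. map (\<lambda>B. of_bool (B \<in> Y)) ss) xs) ! (j * m + i)"
        using b length_concat_rows[OF rows(1)]
        by (simp add: w_def mpc_encode_def nth_append n_def l_def m_def)
      also have "\<dots> = of_bool (cl i = j)"
        using nth_concat_rows[OF rows(2), of j i] j cl_unique[OF j(2,1)] by (simp add: l_def m_def)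
      finally show "f (4 + n + l + m * n + j * m + i) = of_bool (cl i = j)" .
    qed
  qed simp
  then obtain C t s where C: "C \<subseteq> {..<m}" "card C \<le> min K m"
      "\<forall>C'. C' \<subseteq> {..<m} \<and> card C' \<le> min K m \<longrightarrow> val {..<n} C' \<le> val {..<n} C"
    and ex: "exec mpc_program (initial_state w) t s"
      "t \<le> 240 + (n + m + m + l + min K m) * 12 + all_time + m * 50"
      "\<forall>i<m. snd s i = of_bool (i \<in> C)"
    unfolding f_def by (auto elim!: wpE)

  have price: "price X P ((!) ss ` D) = val {..<n} D" if D: "D \<subseteq> {..<m}" for D
  proof -
    have "\<Union>((!) ss ` D) = (!) us ` ({..<n} \<inter> \<Union>(A ` D))"
    proof
      show "(!) us ` ({..<n} \<inter> \<Union>(A ` D)) \<subseteq> \<Union>((!) ss ` D)" by (auto simp: A_def)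
      show "\<Union>((!) ss ` D) \<subseteq> (!) us ` ({..<n} \<inter> \<Union>(A ` D))"
      proof
        fix u assume "u \<in> \<Union>((!) ss ` D)"
        then obtain i where i: "i \<in> D" "u \<in> ss ! i" by blast
        then have "ss ! i \<in> S" using bij_betwE[OF bij(2)] D by auto
        then have "u \<in> U" using SU i by blast
        then obtain e where "e < n" "u = us ! e" using bij_betw_imp_surj_on[OF bij(1)] by auto
        then show "u \<in> (!) us ` ({..<n} \<inter> \<Union>(A ` D))" using i by (auto simp: A_def)
      qed
    qed
    moreover have "inj_on ((!) us) ({..<n} \<inter> \<Union>(A ` D))"
      using bij_betw_imp_inj_on[OF bij(1)] by (rule inj_on_subset) auto
    ultimately have 1: "(\<Sum>e\<in>\<Union>((!) ss ` D). P (Inl e)) = sum pe ({..<n} \<inter> \<Union>(A ` D))"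
      by (simp add: sum.reindex pe_def comp_def)
    have "{Y \<in> X. Y \<inter> (!) ss ` D \<noteq> {}} = (!) xs ` cl ` D"
    proof
      show "(!) xs ` cl ` D \<subseteq> {Y \<in> X. Y \<inter> (!) ss ` D \<noteq> {}}"
      proof
        fix Y assume "Y \<in> (!) xs ` cl ` D"
        then obtain i where i: "i \<in> D" "Y = xs ! cl i" by blast
        then have "i < m" using D by blast
        then have "Y \<in> X" "ss ! i \<in> Y" using cl bij_betwE[OF bij(3)] i by auto
        then show "Y \<in> {Y \<in> X. Y \<inter> (!) ss ` D \<noteq> {}}" using i(1) by blast
      qed
      show "{Y \<in> X. Y \<inter> (!) ss ` D \<noteq> {}} \<subseteq> (!) xs ` cl ` D"
      proof
        fix Y assume "Y \<in> {Y \<in> X. Y \<inter> (!) ss ` D \<noteq> {}}"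
        then obtain i where i: "Y \<in> X" "i \<in> D" "ss ! i \<in> Y" by blast
        then obtain j where "j < l" "Y = xs ! j" using bij_betw_imp_surj_on[OF bij(3)] by auto
        then show "Y \<in> (!) xs ` cl ` D" using i D cl_unique[of i j] by auto
      qed
    qed
    moreover have "inj_on ((!) xs) (cl ` D)"
      using bij_betw_imp_inj_on[OF bij(3)] by (rule inj_on_subset) (use D cl in auto)
    ultimately have 2: "(\<Sum>Y\<in>{Y \<in> X. Y \<inter> (!) ss ` D \<noteq> {}}. P (Inr Y)) = sum pc (cl ` D)"
      by (simp add: sum.reindex pc_def comp_def)
    show ?thesis unfolding price_def val_def 1 2 ..
  qed
  have inj: "inj_on ((!) ss) D" if "D \<subseteq> {..<m}" for D
    using bij_betw_imp_inj_on[OF bij(2)] that by (rule inj_on_subset)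
  have sol: "mpc_solution S X P K ((!) ss ` C)" unfolding mpc_solution_def
  proof (intro conjI allI impI)
    show "(!) ss ` C \<subseteq> S" using C(1) bij_betwE[OF bij(2)] by auto
    show "card ((!) ss ` C) \<le> K" using C(2) by (simp add: card_image inj[OF C(1)])
    fix C' assume C': "C' \<subseteq> S \<and> card C' \<le> K"
    then obtain D where D: "D \<subseteq> {..<m}" "C' = (!) ss ` D"
      using bij_betw_imp_surj_on[OF bij(2)] by (auto elim: subset_imageE)
    \<comment> \<open>The cap is harmless here: a set of indices below \<open>m\<close> has at most
      \<open>m\<close> elements.\<close>
    have "card D \<le> min K m"
      using C' D card_mono[OF _ D(1)] by (simp add: card_image inj)
    then show "price X P C' \<le> price X P ((!) ss ` C)"
      using C(1,3) D by (simp add: price)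
  qed
  have out: "outputs s ss ((!) ss ` C)" unfolding outputs_def
  proof (intro allI impI)
    fix i assume "i < length ss"
    then have i: "i < m" by (simp add: m_def)
    have "ss ! i \<in> (!) ss ` C \<longleftrightarrow> i \<in> C"
      using inj_on_image_mem_iff[OF bij_betw_imp_inj_on[OF bij(2)], of i C] i C(1) by simp
    then show "snd s i = of_bool (ss ! i \<in> (!) ss ` C)" using ex(3) i by simp
  qed
  have cards: "card U = n" "card S = m"
    using bij_betw_same_card[OF bij(1)] bij_betw_same_card[OF bij(2)] by simp_all
  \<comment> \<open>The time bound does not mention the number of classes; it is at most
    \<open>m\<close> because every class contains some set.\<close>
  have "{..<l} \<subseteq> cl ` {..<m}"
  proof
    fix j assume "j \<in> {..<l}"
    then have j: "j < l" "xs ! j \<in> X" using bij_betwE[OF bij(3)] by auto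
    then have "xs ! j \<noteq> {}" "xs ! j \<subseteq> S"
      using partition_onD1[OF part] partition_onD3[OF part] by auto
    then obtain i where "i < m" "ss ! i \<in> xs ! j"
      using bij_betw_imp_surj_on[OF bij(2)] by blast
    then show "j \<in> cl ` {..<m}" using cl_unique j(1) by blast
  qed
  then have "l \<le> m" using surj_card_le[of "{..<m}" "{..<l}" cl] by simp
  define q where "q = max 1 (card U + card S)"
  have q: "1 \<le> q" "n \<le> q" "m \<le> q" by (auto simp: q_def cards)
  have "t \<le> 2000 * (2 ^ n * q ^ 3)"
    using ex(2) time_bound[of q] q \<open>l \<le> m\<close> by linarith
  \<comment> \<open>The bound uses one constant as both factor and exponent; as
    \<open>q \<ge> 1\<close>, the exponent 3 may be raised to the factor 2000.\<close>
  also have "\<dots> \<le> 2000 * (2 ^ n * q ^ 2000)"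
    by (intro mult_left_mono power_increasing q) simp_all
  finally have "t \<le> mpc_time_bound 2000 U S"
    unfolding mpc_time_bound_def q_def[symmetric] unfolding cards(1) by (simp only: mult.assoc)
  then show "\<exists>t s C. exec mpc_program (initial_state (mpc_encode us ss xs P K)) t s
      \<and> t \<le> mpc_time_bound 2000 U S \<and> outputs s ss C \<and> mpc_solution S X P K C"
    using ex(1) out sol unfolding w_def by (intro exI conjI)
qed

end
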